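(* Let $(\mathbf K,\mathbf V,\mathbf P)$ be an ordered valued subfield of a real closed valued field $(\mathbf R,\mathbf V_{\mathbf R},\mathbf P_{\mathbf R})$. Any $(\leq,\preceq)$-constructible subset of $\mathbf R$ defined over $(\mathbf K,\mathbf V,\mathbf P)$ is a finite disjoint union of points in $\mathbf K^{\mathrm{rc}}$ and of $(<,\preceq)$-intervals defined over $(\mathbf K,\mathbf V,\mathbf P)$.
   Context: An ordered valued field is a triple $(\mathbf K,\mathbf V,\mathbf P)$ where $\mathbf K$ is an ordered field with set of nonnegative elements $\mathbf P$ and $\mathbf V\subsetneq\mathbf K$ is a valuation ring that is convex (if $x,y\in\mathbf P$ and $x+y\in\mathbf V$ then $x\in\mathbf V$). The valuation is $v$, the value group (additive, ordered) is $\Gamma_{\mathbf K}$, $v(0)=+\infty$. A real closed valued field is an ordered valued field whose underlying field is real closed. An ordered valued subfield carries the induced order and valuation ring. $\mathbf K^{\mathrm{rc}}$ is the real closure of $\mathbf K$ (here identified with the algebraic closure of $\mathbf K$ in $\mathbf R$); its value group is the divisible hull $\Gamma_{\mathbf K}^{dh}$ of $\Gamma_{\mathbf K}$. A valued sign condition (vsc) on a finite family $(x_j)_{j=1,\ldots,m}$ of elements is a condition of the form $$\bigwedge_{j\in J}\operatorname{sign}(x_j)=\sigma_j\ \land\ \bigwedge_{\ell\in L}\operatorname{sign}\Big(\sum_{j\in J,\ \sigma_j\ne0}\ell_jv(x_j)\Big)=\sigma'_\ell,$$ where $J\subseteq\{1,\ldots,m\}$, $L$ is a finite subset of $\mathbb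 Z^{\{j\in J:\sigma_j\neq0\}}$ and $\sigma_j,\sigma'_\ell\in\{-1,0,1\}$. A basic $(\leq,\preceq)$-constructible subset of $\mathbf R^n$ defined over $(\mathbf K,\mathbf V,\mathbf P)$ is the set of $\underline x\in\mathbf R^n$ such that the values $P_j(\underline x)$ of a finite family $(P_j)$ in $\mathbf K[X_1,\ldots,X_n]$ satisfy a given system of vsc's; a $(\leq,\preceq)$-constructible set defined over $(\mathbf K,\mathbf V,\mathbf P)$ is a boolean combination of basic ones. The $(<,\preceq)$-intervals defined over $(\mathbf K,\mathbf V,\mathbf P)$ are the following subsets of $\mathbf R$. For $a\in\mathbf K^{\mathrm{rc}}$, $\alpha\in\Gamma_{\mathbf K}^{dh}$: $\mathbb I^{\pm}(a,\alpha)=\{x=a\pm t:\ 0<t,\ v(t)=\alpha\}$. For $a\in\mathbf K^{\mathrm{rc}}$, $\alpha<\beta$ in $\Gamma_{\mathbf K}^{dh}\cup\{\pm\infty\}$: $\mathbb I^{\pm}(a,\alpha,\beta)=\{x=a\pm t:\ 0<t,\ \alpha<v(t)<\beta\}$. For $a<b$ in $\mathbf K^{\mathrm{rc}}$, $0<\alpha\in\Gamma_{\mathbf K}^{dh}$: $\mathbb J^{+}(a,b,\alpha)=\{x=a+t(b-a):\ 0<t,\ v(t)=\alpha\}$ and $\mathbb J^{-}(a,b,\alpha)=\{x=b-t(b-a):\ 0<t,\ v(t)=\alpha\}$. For $a<b$ in $\mathbf K^{\mathrm{rc}}$, $0\le\alpha<\beta$ in $\Gamma_{\mathbf K}^{dh}\cup\{+\infty\}$: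 $\mathbb J^{+}(a,b,\alpha,\beta)=\{x=a+t(b-a):\ 0<t,\ \alpha<v(t)<\beta\}$ and $\mathbb J^{-}(a,b,\alpha,\beta)=\{x=b-t(b-a):\ 0<t,\ \alpha<v(t)<\beta\}$. For $a<b$ in $\mathbf K^{\mathrm{rc}}$: $\mathbb J(a,b)=\{x=a+t(b-a):\ 0<t<1,\ v(t)=v(1-t)=0\}$. (In all of these $x,t$ range over $\mathbf R$.) *)

theory Defs
  imports
    "HOL-Computational_Algebra.Polynomial"
    "HOL-Library.Extended"
    "HOL-Library.FuncSet"
    "HOL-Library.Disjoint_Sets"
begin

section \<open>Real closed fields\<close>

text \<open>The second axiom says that polynomials of odd degree have a root; as for
  \<^class>\<open>alg_closed_field\<close>, a polynomial is given by its coefficients.\<close>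

class real_closed_field = linordered_field +
  assumes nonneg_is_square: "0 \<le> x \<Longrightarrow> \<exists>y. y * y = x"
    and odd_degree_root: "odd n \<Longrightarrow> f n \<noteq> 0 \<Longrightarrow> \<exists>x. (\<Sum>k\<le>n. f k * x ^ k) = 0"


section \<open>Ordered valued fields\<close>

text \<open>All fields live inside an ambient ordered field \<^typ>\<open>'r\<close> and carry the induced order,
  so the set of nonnegative elements of a subfield \<open>K\<close> is \<open>{x \<in> K. 0 \<le> x}\<close>.\<close>

definition is_subring :: "'r::field set \<Rightarrow> bool" where
  "is_subring A \<longleftrightarrow> 1 \<in> A \<and> (\<forall>x\<in>A. \<forall>y\<in>A. x - y \<in> A \<and> x * y \<in> A)"

definition is_subfield :: "'r::field set \<Rightarrow> bool" where
  "is_subfield K \<longleftrightarrow> is_subring K \<and> (\<forall>x\<in>K. inverse x \<in> K)"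

definition valuation_ring :: "'r::field set \<Rightarrow> 'r set \<Rightarrow> bool" where
  "valuation_ring K V \<longleftrightarrow>
     is_subring V \<and> V \<subseteq> K \<and> (\<forall>x\<in>K. x \<noteq> 0 \<longrightarrow> x \<in> V \<or> inverse x \<in> V)"

definition ordered_valued_field :: "'r::linordered_field set \<Rightarrow> 'r set \<Rightarrow> bool" where
  "ordered_valued_field K V \<longleftrightarrow>
     is_subfield K \<and> valuation_ring K V \<and> V \<noteq> K \<and>
     (\<forall>x\<in>K. \<forall>y\<in>K. 0 \<le> x \<longrightarrow> 0 \<le> y \<longrightarrow> x + y \<in> V \<longrightarrow> x \<in> V)"

definition ordered_valued_subfield ::
    "'r::linordered_field set \<Rightarrow> 'r set \<Rightarrow> 'r set \<Rightarrow> 'r set \<Rightarrow> bool" where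
  "ordered_valued_subfield K V L W \<longleftrightarrow>
     ordered_valued_field K V \<and> ordered_valued_field L W \<and> K \<subseteq> L \<and> V = W \<inter> K"

text \<open>\<open>v\<close> is the valuation of the field \<^typ>\<open>'r\<close> with valuation ring \<open>V\<close>, and \<^typ>\<open>'g\<close> is its value
  group; these axioms determine \<open>v\<close> up to a unique isomorphism of ordered groups, \<open>V\<close> being a
  valuation ring. The value at \<open>0\<close> is left unspecified and is never used below: wherever \<open>v x\<close>
  matters, \<open>x \<noteq> 0\<close>. The convention \<open>v 0 = \<infinity>\<close> thus plays no role.\<close>

definition valuation_of :: "'r::field set \<Rightarrow> ('r \<Rightarrow> 'g::linordered_ab_group_add) \<Rightarrow> bool" where
  "valuation_of V v \<longleftrightarrow>
     (\<forall>x y. x \<noteq> 0 \<longrightarrow> y \<noteq> 0 \<longrightarrow> v (x * y) = v x + v y) \<and>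
     v ` (- {0}) = UNIV \<and>
     (\<forall>x. x \<noteq> 0 \<longrightarrow> (0 \<le> v x \<longleftrightarrow> x \<in> V))"

text \<open>Multiplication by integers in an additive group.\<close>

definition zmult :: "int \<Rightarrow> 'g::ab_group_add \<Rightarrow> 'g" where
  "zmult k g = (\<Sum>i<nat k. g) - (\<Sum>i<nat (- k). g)"

definition value_group :: "'r::field set \<Rightarrow> ('r \<Rightarrow> 'g) \<Rightarrow> 'g set" where
  "value_group K v = v ` (K - {0})"

text \<open>The divisible hull, formed inside the (torsion-free, divisible) value group \<^typ>\<open>'g\<close> of a real
  closed field.\<close>

definition div_hull :: "'g::linordered_ab_group_add set \<Rightarrow> 'g set" where
  "div_hull \<Gamma> = {g. \<exists>n>0. zmult n g \<in> \<Gamma>}"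

definition polys_over :: "'r::field set \<Rightarrow> 'r poly set" where
  "polys_over K = {p. \<forall>i. coeff p i \<in> K}"

definition alg_closure_in :: "'r::field set \<Rightarrow> 'r set" where
  "alg_closure_in K = {x. \<exists>p\<in>polys_over K. p \<noteq> 0 \<and> poly p x = 0}"


section \<open>Constructible subsets of the line\<close>

definition sign :: "'a::{linorder,zero} \<Rightarrow> int" where
  "sign x = (if x < 0 then - 1 else if x = 0 then 0 else 1)"

definition vsc_holds ::
    "('r::linordered_field \<Rightarrow> 'g::linordered_ab_group_add) \<Rightarrow> nat set \<Rightarrow> (nat \<Rightarrow> int) \<Rightarrow>
     (nat \<Rightarrow> int) set \<Rightarrow> ((nat \<Rightarrow> int) \<Rightarrow> int) \<Rightarrow> (nat \<Rightarrow> 'r) \<Rightarrow> bool" where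
  "vsc_holds v J \<sigma> L \<tau> x \<longleftrightarrow>
     (\<forall>j\<in>J. sign (x j) = \<sigma> j) \<and>
     (\<forall>l\<in>L. sign (\<Sum>j | j \<in> J \<and> \<sigma> j \<noteq> 0. zmult (l j) (v (x j))) = \<tau> l)"

text \<open>The valued sign conditions on families indexed by \<open>{1..m}\<close>.\<close>

definition vscs ::
    "('r::linordered_field \<Rightarrow> 'g::linordered_ab_group_add) \<Rightarrow> nat \<Rightarrow> ((nat \<Rightarrow> 'r) \<Rightarrow> bool) set" where
  "vscs v m = {vsc_holds v J \<sigma> L \<tau> | J \<sigma> L \<tau>.
     J \<subseteq> {1..m} \<and> \<sigma> \<in> J \<rightarrow> {- 1, 0, 1} \<and>
     finite L \<and> L \<subseteq> {j \<in> J. \<sigma> j \<noteq> 0} \<rightarrow>\<^sub>E UNIV \<and> \<tau> \<in> L \<rightarrow> {- 1, 0, 1}}"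

definition basic_constructible ::
    "'r::linordered_field set \<Rightarrow> ('r \<Rightarrow> 'g::linordered_ab_group_add) \<Rightarrow> 'r set \<Rightarrow> bool" where
  "basic_constructible K v S \<longleftrightarrow>
     (\<exists>m P F. (\<forall>j\<in>{1..m}. P j \<in> polys_over K) \<and> finite F \<and> F \<subseteq> vscs v m \<and>
        S = {x. \<forall>C\<in>F. C (\<lambda>j. poly (P j) x)})"

inductive constructible ::
    "'r::linordered_field set \<Rightarrow> ('r \<Rightarrow> 'g::linordered_ab_group_add) \<Rightarrow> 'r set \<Rightarrow> bool"
  for K v where
  basic: "basic_constructible K v S \<Longrightarrow> constructible K v S"
| compl: "constructible K v S \<Longrightarrow> constructible K v (- S)"
| union: "constructible K v S \<Longrightarrow> constructible K v T \<Longrightarrow> constructible K v (S \<union> T)"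
| inter: "constructible K v S \<Longrightarrow> constructible K v T \<Longrightarrow> constructible K v (S \<inter> T)"


section \<open>Intervals\<close>

context
  fixes v :: "'r::linordered_field \<Rightarrow> 'g::linordered_ab_group_add"
begin

definition Ival_plus :: "'r \<Rightarrow> 'g \<Rightarrow> 'r set" where
  "Ival_plus a \<alpha> = {a + t | t. 0 < t \<and> v t = \<alpha>}"

definition Ival_minus :: "'r \<Rightarrow> 'g \<Rightarrow> 'r set" where
  "Ival_minus a \<alpha> = {a - t | t. 0 < t \<and> v t = \<alpha>}"

definition Iopen_plus :: "'r \<Rightarrow> 'g extended \<Rightarrow> 'g extended \<Rightarrow> 'r set" where
  "Iopen_plus a \<alpha> \<beta> = {a + t | t. 0 < t \<and> \<alpha> < Fin (v t) \<and> Fin (v t) < \<beta>}"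

definition Iopen_minus :: "'r \<Rightarrow> 'g extended \<Rightarrow> 'g extended \<Rightarrow> 'r set" where
  "Iopen_minus a \<alpha> \<beta> = {a - t | t. 0 < t \<and> \<alpha> < Fin (v t) \<and> Fin (v t) < \<beta>}"

definition Jval_plus :: "'r \<Rightarrow> 'r \<Rightarrow> 'g \<Rightarrow> 'r set" where
  "Jval_plus a b \<alpha> = {a + t * (b - a) | t. 0 < t \<and> v t = \<alpha>}"

definition Jval_minus :: "'r \<Rightarrow> 'r \<Rightarrow> 'g \<Rightarrow> 'r set" where
  "Jval_minus a b \<alpha> = {b - t * (b - a) | t. 0 < t \<and> v t = \<alpha>}"

definition Jopen_plus :: "'r \<Rightarrow> 'r \<Rightarrow> 'g extended \<Rightarrow> 'g extended \<Rightarrow> 'r set" where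
  "Jopen_plus a b \<alpha> \<beta> = {a + t * (b - a) | t. 0 < t \<and> \<alpha> < Fin (v t) \<and> Fin (v t) < \<beta>}"

definition Jopen_minus :: "'r \<Rightarrow> 'r \<Rightarrow> 'g extended \<Rightarrow> 'g extended \<Rightarrow> 'r set" where
  "Jopen_minus a b \<alpha> \<beta> = {b - t * (b - a) | t. 0 < t \<and> \<alpha> < Fin (v t) \<and> Fin (v t) < \<beta>}"

definition Jmid :: "'r \<Rightarrow> 'r \<Rightarrow> 'r set" where
  "Jmid a b = {a + t * (b - a) | t. 0 < t \<and> t < 1 \<and> v t = 0 \<and> v (1 - t) = 0}"

end

text \<open>The parameters \<open>A\<close> and \<open>D\<close> are the sets in which end points and values range;
  they are instantiated with the real closure of \<open>K\<close> and its value group.\<close>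

inductive interval_over ::
    "'r::linordered_field set \<Rightarrow> 'g set \<Rightarrow> ('r \<Rightarrow> 'g::linordered_ab_group_add) \<Rightarrow> 'r set \<Rightarrow> bool"
  for A D v where
  "a \<in> A \<Longrightarrow> \<alpha> \<in> D \<Longrightarrow> interval_over A D v (Ival_plus v a \<alpha>)"
| "a \<in> A \<Longrightarrow> \<alpha> \<in> D \<Longrightarrow> interval_over A D v (Ival_minus v a \<alpha>)"
| "a \<in> A \<Longrightarrow> \<alpha> \<in> Fin ` D \<union> {Minf, Pinf} \<Longrightarrow> \<beta> \<in> Fin ` D \<union> {Minf, Pinf} \<Longrightarrow> \<alpha> < \<beta> \<Longrightarrow>
     interval_over A D v (Iopen_plus v a \<alpha> \<beta>)"
| "a \<in> A \<Longrightarrow> \<alpha> \<in> Fin ` D \<union> {Minf, Pinf} \<Longrightarrow> \<beta> \<in> Fin ` D \<union> {Minf, Pinf} \<Longrightarrow> \<alpha> < \<beta> \<Longrightarrow>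
     interval_over A D v (Iopen_minus v a \<alpha> \<beta>)"
| "a \<in> A \<Longrightarrow> b \<in> A \<Longrightarrow> a < b \<Longrightarrow> \<alpha> \<in> D \<Longrightarrow> 0 < \<alpha> \<Longrightarrow> interval_over A D v (Jval_plus v a b \<alpha>)"
| "a \<in> A \<Longrightarrow> b \<in> A \<Longrightarrow> a < b \<Longrightarrow> \<alpha> \<in> D \<Longrightarrow> 0 < \<alpha> \<Longrightarrow> interval_over A D v (Jval_minus v a b \<alpha>)"
| "a \<in> A \<Longrightarrow> b \<in> A \<Longrightarrow> a < b \<Longrightarrow> \<alpha> \<in> Fin ` D \<union> {Pinf} \<Longrightarrow> \<beta> \<in> Fin ` D \<union> {Pinf} \<Longrightarrow>
     0 \<le> \<alpha> \<Longrightarrow> \<alpha> < \<beta> \<Longrightarrow> interval_over A D v (Jopen_plus v a b \<alpha> \<beta>)"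
| "a \<in> A \<Longrightarrow> b \<in> A \<Longrightarrow> a < b \<Longrightarrow> \<alpha> \<in> Fin ` D \<union> {Pinf} \<Longrightarrow> \<beta> \<in> Fin ` D \<union> {Pinf} \<Longrightarrow>
     0 \<le> \<alpha> \<Longrightarrow> \<alpha> < \<beta> \<Longrightarrow> interval_over A D v (Jopen_minus v a b \<alpha> \<beta>)"
| "a \<in> A \<Longrightarrow> b \<in> A \<Longrightarrow> a < b \<Longrightarrow> interval_over A D v (Jmid v a b)"

definition vo_interval ::
    "'r::linordered_field set \<Rightarrow> ('r \<Rightarrow> 'g::linordered_ab_group_add) \<Rightarrow> 'r set \<Rightarrow> bool" where
  "vo_interval K v = interval_over (alg_closure_in K) (div_hull (value_group K v)) v"

end

(*
  In the algebraic closure of R, every root of a polynomial P over K has the form a + ib with a and b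
  algebraic over K, so P is a product of a constant in K and of factors x - a and (x - a)^2 + b^2.
  The valuation is convex, so v(s + t) = min(v(s), v(t)) for s, t > 0, and therefore
  v((x - a)^2 + b^2) = 2 min(v(x - a), v(b)). Let A be a finite set containing all these a. Between
  two consecutive elements a < b of A, put t = (x - a) / (b - a). One of v(t), v(1 - t) is 0, and where
  v(t) > 0, where v(1 - t) > 0 and where both vanish, each v(x - c) with c in A is a piecewise linear
  function of v(t), of v(1 - t), or constant; beyond the extreme elements of A the parameter is the
  value of the distance to that element. On each such region a valued sign condition thus becomes a
  condition on the sign of a piecewise linear function of one parameter in the value group, with
  breakpoints in the divisible hull, and cuts the region into finitely many intervals.
*)
theory Submission
  imports "HOL-Algebra.Algebraic_Closure_Type" "HOL-Computational_Algebra.Polynomial_FPS" Defs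
begin

section \<open>Newton sums and algebraic elements\<close>

text \<open>The axioms of a real closed field supply only square roots and zeros of polynomials of
  odd degree. That R(i) contains roots of all real polynomials, and that the resulting a and b are
  algebraic over K, must therefore be derived. Both facts rest on the same dictionary: a list has
  its Newton sums in a subfield exactly when the monic polynomial with these roots has its
  coefficients there, and Newton sums of lists of sums, products or pair products can be computed
  directly. The breakpoints involve v(b) and v(a - c), which have to lie in the divisible hull. They
  do because positive terms never cancel: in a relation p(b) = 0 two terms must have the same value.
  The regions depend on all the numbers a together, while a constructible set is built up from
  pieces that know only their own polynomials. The property carried through the boolean operations
  is therefore stated for every region and every parameter in which the values v(x - a) are
  piecewise linear. Boolean operations then only enlarge the set of these a, and the actual regions
  are chosen once, at the end.\<close>

lemma is_subfieldD:
  assumes "is_subfield F"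
  shows is_subfield_0: "0 \<in> F" and is_subfield_1: "1 \<in> F"
    and is_subfield_diff: "x \<in> F \<Longrightarrow> y \<in> F \<Longrightarrow> x - y \<in> F"
    and is_subfield_minus: "x \<in> F \<Longrightarrow> - x \<in> F"
    and is_subfield_add: "x \<in> F \<Longrightarrow> y \<in> F \<Longrightarrow> x + y \<in> F"
    and is_subfield_mult: "x \<in> F \<Longrightarrow> y \<in> F \<Longrightarrow> x * y \<in> F"
    and is_subfield_inverse: "x \<in> F \<Longrightarrow> inverse x \<in> F"
    and is_subfield_divide: "x \<in> F \<Longrightarrow> y \<in> F \<Longrightarrow> x / y \<in> F"
proof -
  have 1: "1 \<in> F" and diff: "\<And>x y. x \<in> F \<Longrightarrow> y \<in> F \<Longrightarrow> x - y \<in> F"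
    and mult: "\<And>x y. x \<in> F \<Longrightarrow> y \<in> F \<Longrightarrow> x * y \<in> F"
    and inv: "\<And>x. x \<in> F \<Longrightarrow> inverse x \<in> F"
    using assms by (auto simp: is_subfield_def is_subring_def)
  have 0: "0 \<in> F" using diff[OF 1 1] by simp
  have minus: "- x \<in> F" if "x \<in> F" for x using diff[OF 0 that] by simp
  have add: "x + y \<in> F" if "x \<in> F" "y \<in> F" for x y
    using diff[OF that(1) minus[OF that(2)]] by simp
  show "0 \<in> F" "1 \<in> F" by (fact 0, fact 1)
  show "x \<in> F \<Longrightarrow> y \<in> F \<Longrightarrow> x - y \<in> F" "x \<in> F \<Longrightarrow> - x \<in> F"
    "x \<in> F \<Longrightarrow> y \<in> F \<Longrightarrow> x + y \<in> F" "x \<in> F \<Longrightarrow> y \<in> F \<Longrightarrow> x * y \<in> F" "x \<in> F \<Longrightarrow> inverse x \<in> F"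
    "x \<in> F \<Longrightarrow> y \<in> F \<Longrightarrow> x / y \<in> F"
    by (simp_all add: diff mult inv minus add field_class.field_divide_inverse)
qed

lemma is_subfield_power: "is_subfield F \<Longrightarrow> x \<in> F \<Longrightarrow> x ^ k \<in> F"
  by (induction k) (auto intro: is_subfieldD)

lemma is_subfield_sum: "is_subfield F \<Longrightarrow> (\<And>i. i \<in> I \<Longrightarrow> f i \<in> F) \<Longrightarrow> sum f I \<in> F"
  by (induction I rule: infinite_finite_induct) (auto intro: is_subfieldD)

lemma is_subfield_of_nat: "is_subfield F \<Longrightarrow> of_nat n \<in> F"
  by (induction n) (auto intro: is_subfieldD)

text \<open>Power sums of a list rather than of a set, because roots count with multiplicity. For
  exponent 0 the sum is the length of the list.\<close>

definition newton_sum :: "nat \<Rightarrow> 'a::semiring_1 list \<Rightarrow> 'a" where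
  "newton_sum k zs = (\<Sum>z\<leftarrow>zs. z ^ k)"

definition root_poly :: "'a::comm_ring_1 list \<Rightarrow> 'a poly" where
  "root_poly zs = (\<Prod>z\<leftarrow>zs. [:- z, 1:])"

lemma root_poly_simps [simp]:
  "root_poly [] = 1" "root_poly (z # zs) = [:- z, 1:] * root_poly zs"
  by (simp_all add: root_poly_def)

lemma monic_root_poly: 
  "lead_coeff (root_poly zs) = (1 :: 'a :: idom) \<and> degree (root_poly zs) = length zs"
proof (induction zs)
  case (Cons z zs)
  hence "root_poly zs \<noteq> 0" by auto
  hence "degree ([:- z, 1:] * root_poly zs) = length (z # zs)"
    using Cons by (subst degree_mult_eq) auto
  moreover have "lead_coeff ([:- z, 1:] * root_poly zs) = 1"
    using Cons by (subst lead_coeff_mult) auto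
  ultimately show ?case by simp
qed simp

lemma poly_root_poly_eq_0_iff: "poly (root_poly zs) (x::'a::idom) = 0 \<longleftrightarrow> x \<in> set zs"
  by (induction zs) auto

text \<open>The reflected polynomial is \<open>\<Prod>(1 - z X)\<close>, whose logarithmic derivative is the generating
  function of the Newton sums.\<close>

lemma newton_identity:
  fixes zs :: "'a::field_char_0 list"
  defines "f \<equiv> fps_of_poly (reflect_poly (root_poly zs))"
  shows "fps_deriv f = - f * Abs_fps (\<lambda>k. newton_sum (Suc k) zs)"
  unfolding f_def
proof (induction zs)
  case Nil
  show ?case by (simp add: newton_sum_def fps_eq_iff)
next
  case (Cons z zs)
  define g where "g = fps_of_poly (reflect_poly (root_poly zs))"
  define l where "l = 1 - fps_const z * fps_X"
  define G where "G = Abs_fps (\<lambda>k. newton_sum (Suc k) zs)"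
  define H where "H = Abs_fps (\<lambda>k. z ^ Suc k)"
  have refl: "reflect_poly [:-z, 1:] = [:1, -z:]"
    by (simp add: reflect_poly_def)
  have 1: "fps_of_poly (reflect_poly (root_poly (z # zs))) = l * g"
    unfolding root_poly_simps reflect_poly_mult refl fps_of_poly_mult g_def l_def
    by (simp add: fps_of_poly_pCons algebra_simps)
  have 2: "Abs_fps (\<lambda>k. newton_sum (Suc k) (z # zs)) = H + G"
    by (simp add: fps_eq_iff newton_sum_def H_def G_def)
  have 3: "l * H = fps_const z"
  proof (rule fps_ext)
    fix n show "fps_nth (l * H) n = fps_nth (fps_const z) n"
      by (cases n) (simp_all add: l_def H_def algebra_simps mult.assoc)
  qed
  have 4: "fps_deriv l = - fps_const z"
    by (simp add: l_def)
  have "fps_deriv (l * g) = l * fps_deriv g - fps_const z * g"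
    by (simp add: 4 algebra_simps flip: fps_const_neg)
  also have "\<dots> = - (l * g) * (H + G)"
    using Cons 3 unfolding g_def[symmetric] G_def[symmetric] by (simp add: algebra_simps flip: 3)
  finally show ?case unfolding 1 2 .
qed

text \<open>Comparing coefficients in \<open>newton_identity\<close> gives (k+1) r_(k+1) = - sum
  over j <= k of r_j p_(k+1-j), where r_j are the reflected coefficients and p_j the Newton sums.
  Since r_0 = 1 this determines p_(k+1) from the coefficients and the earlier sums; since the
  characteristic is 0 it also determines r_(k+1) from the sums and the earlier coefficients.
  Reflection only reverses the order of the coefficients.\<close>

lemma coeffs_in_subfield_iff:
  fixes zs :: "'a::field_char_0 list"
  assumes F: "is_subfield F"
  shows "(\<forall>k. coeff (root_poly zs) k \<in> F) \<longleftrightarrow> (\<forall>k. newton_sum k zs \<in> F)"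
proof -
  define r where "r = reflect_poly (root_poly zs)"
  define n where "n = length zs"
  have deg: "degree (root_poly zs) = n" and lead: "coeff (root_poly zs) n = 1"
    using monic_root_poly[of zs] by (auto simp: n_def)
  have r0: "coeff r 0 = 1"
    using lead by (simp add: r_def deg)
  have rk: "coeff r k = (if k > n then 0 else coeff (root_poly zs) (n - k))" for k
    unfolding r_def coeff_reflect_poly deg ..
  have "coeff (root_poly zs) k = (if k > n then 0 else coeff r (n - k))" for k
    by (auto simp: rk deg coeff_eq_0)
  hence refl: "(\<forall>k. coeff (root_poly zs) k \<in> F) \<longleftrightarrow> (\<forall>k. coeff r k \<in> F)"
    using rk is_subfield_0[OF F] by (metis (full_types))
  have rec: "of_nat (Suc k) * coeff r (Suc k) = - (\<Sum>j=0..k. coeff r j * newton_sum (Suc (k - j)) zs)" for k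
    using arg_cong[OF newton_identity[of zs], of "\<lambda>f. fps_nth f k"]
    by (simp add: r_def[symmetric] fps_mult_nth sum_negf)
  show ?thesis
    unfolding refl
  proof safe
    fix k assume coeffs: "\<forall>k. coeff r k \<in> F"
    show "newton_sum k zs \<in> F"
    proof (induction k rule: less_induct)
      case (less k)
      show ?case
      proof (cases k)
        case 0
        have "newton_sum 0 zs = of_nat (length zs)"
          by (simp add: newton_sum_def map_replicate_const sum_list_replicate)
        then show ?thesis by (simp add: 0 is_subfield_of_nat F)
      next
        case (Suc l)
        have "newton_sum (Suc l) zs = - (of_nat (Suc l) * coeff r (Suc l))
                - (\<Sum>j=Suc 0..l. coeff r j * newton_sum (Suc (l - j)) zs)"
          using rec[of l]
          by (simp add: sum.atLeast_Suc_atMost r0 algebra_simps eq_neg_iff_add_eq_0 del: add_eq_0_iff)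
        also have "\<dots> \<in> F"
          using coeffs less.IH
          by (intro is_subfieldD[OF F] is_subfield_sum[OF F] is_subfield_of_nat[OF F])
            (auto simp: Suc)
        finally show ?thesis by (simp add: Suc)
      qed
    qed
  next
    fix k assume sums: "\<forall>k. newton_sum k zs \<in> F"
    show "coeff r k \<in> F"
    proof (induction k rule: less_induct)
      case (less k)
      show ?case
      proof (cases k)
        case 0
        then show ?thesis by (simp add: r0 is_subfield_1 F)
      next
        case (Suc l)
        have "coeff r (Suc l) = - (\<Sum>j=0..l. coeff r j * newton_sum (Suc (l - j)) zs) / of_nat (Suc l)"
          unfolding rec[symmetric] by (simp del: of_nat_Suc)
        also have "\<dots> \<in> F"
          using sums less.IH
          by (intro is_subfieldD[OF F] is_subfield_sum[OF F] is_subfield_of_nat[OF F])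
            (auto simp: Suc)
        finally show ?thesis by (simp add: Suc)
      qed
    qed
  qed
qed

text \<open>Describing algebraic elements by Newton sums makes closure under sums and products a direct
  computation: no symmetric polynomials or resultants are needed.\<close>

definition algebraic_over :: "'a::field_char_0 set \<Rightarrow> 'a \<Rightarrow> bool" where
  "algebraic_over F z \<longleftrightarrow> (\<exists>zs. z \<in> set zs \<and> (\<forall>k. newton_sum k zs \<in> F))"

text \<open>The binomial theorem writes the new sums as combinations of the old ones with
  coefficients in \<open>F\<close>. Laplace's argument uses it for z -> 1 + c z.\<close>

lemma newton_sum_in_subfield_map:
  assumes F: "is_subfield F" and zs: "\<forall>k. newton_sum k zs \<in> F" and a: "a \<in> F" "b \<in> F"
  shows "newton_sum k (map (\<lambda>z. a + b * z) zs) \<in> F"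
proof -
  have "(a + b * z) ^ k = (\<Sum>i\<le>k. (of_nat (k choose i) * a ^ (k - i) * b ^ i) * z ^ i)" for z
    by (simp add: binomial_ring[of "b * z" a] add.commute[of a] power_mult_distrib mult_ac)
  hence "newton_sum k (map (\<lambda>z. a + b * z) zs)
        = (\<Sum>z\<leftarrow>zs. \<Sum>i\<le>k. (of_nat (k choose i) * a ^ (k - i) * b ^ i) * z ^ i)"
    by (simp add: newton_sum_def o_def)
  also have "\<dots> = (\<Sum>i\<le>k. (of_nat (k choose i) * a ^ (k - i) * b ^ i) * newton_sum i zs)"
    unfolding newton_sum_def sum_list_const_mult[symmetric]
    by (induction zs) (simp_all add: sum.distrib)
  also have "\<dots> \<in> F"
    using zs a by (intro is_subfieldD[OF F] is_subfield_sum[OF F] is_subfield_of_nat[OF F] is_subfield_power[OF F]) auto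
  finally show ?thesis .
qed

lemma sum_list_concat_map: "sum_list (concat (map f xs)) = (\<Sum>x\<leftarrow>xs. sum_list (f x))"
  by (induction xs) auto

text \<open>The witness is the list of all sums of one entry from each list. The binomial theorem
  separates its Newton sums into products of Newton sums of the two lists.\<close>

lemma algebraic_over_add:
  assumes F: "is_subfield F" and "algebraic_over F z" "algebraic_over F w"
  shows "algebraic_over F (z + w)"
proof -
  obtain zs ws where zs: "z \<in> set zs" "\<forall>k. newton_sum k zs \<in> F" and ws: "w \<in> set ws" "\<forall>k. newton_sum k ws \<in> F"
    using assms(2,3) by (auto simp: algebraic_over_def)
  define us where "us = concat (map (\<lambda>z. map (\<lambda>w. z + w) ws) zs)"
  have "newton_sum k us \<in> F" for k
  proof -
    have 1: "(\<Sum>w\<leftarrow>ws. (z + w) ^ k) = (\<Sum>i\<le>k. of_nat (k choose i) * z ^ i * newton_sum (k - i) ws)" for z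
      unfolding newton_sum_def binomial_ring sum_list_const_mult[symmetric]
      by (induction ws) (simp_all add: sum.distrib)
    have "newton_sum k us = (\<Sum>z\<leftarrow>zs. \<Sum>w\<leftarrow>ws. (z + w) ^ k)"
      by (simp add: newton_sum_def us_def map_concat o_def sum_list_concat_map)
    also have "\<dots> = (\<Sum>i\<le>k. of_nat (k choose i) * newton_sum i zs * newton_sum (k - i) ws)"
      unfolding 1 newton_sum_def[of _ zs]
      by (induction zs) (simp_all add: sum.distrib algebra_simps)
    also have "\<dots> \<in> F"
      using zs ws by (intro is_subfieldD[OF F] is_subfield_sum[OF F] is_subfield_of_nat[OF F]) auto
    finally show ?thesis .
  qed
  moreover have "z + w \<in> set us" using zs ws by (auto simp: us_def)
  ultimately show ?thesis by (auto simp: algebraic_over_def)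
qed

text \<open>For the list of all products the double sum factors, so its Newton sums are the products
  of the given ones.\<close>

lemma algebraic_over_mult:
  assumes F: "is_subfield F" and "algebraic_over F z" "algebraic_over F w"
  shows "algebraic_over F (z * w)"
proof -
  obtain zs ws where zs: "z \<in> set zs" "\<forall>k. newton_sum k zs \<in> F" and ws: "w \<in> set ws" "\<forall>k. newton_sum k ws \<in> F"
    using assms(2,3) by (auto simp: algebraic_over_def)
  define us where "us = concat (map (\<lambda>z. map (\<lambda>w. z * w) ws) zs)"
  have "newton_sum k us \<in> F" for k
  proof -
    have "newton_sum k us = (\<Sum>z\<leftarrow>zs. \<Sum>w\<leftarrow>ws. (z * w) ^ k)"
      by (simp add: newton_sum_def us_def map_concat o_def sum_list_concat_map)
    also have "\<dots> = newton_sum k zs * newton_sum k ws"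
      by (simp add: newton_sum_def power_mult_distrib sum_list_const_mult sum_list_mult_const)
    also have "\<dots> \<in> F"
      using zs ws by (intro is_subfieldD[OF F]) auto
    finally show ?thesis .
  qed
  moreover have "z * w \<in> set us" using zs ws by (auto simp: us_def)
  ultimately show ?thesis by (auto simp: algebraic_over_def)
qed

lemma splits_root_poly:
  fixes p :: "'a::alg_closed_field poly"
  assumes "p \<noteq> 0"
  obtains zs where "p = smult (lead_coeff p) (root_poly zs)"
proof -
  obtain A where A: "p = smult (lead_coeff p) (\<Prod>x\<in>#A. [:-x, 1:])"
    using alg_closed_imp_factorization[OF assms] by blast
  obtain zs where zs: "mset zs = A" using ex_mset by blast
  have "(\<Prod>x\<in>#A. [:-x, 1:]) = root_poly zs"
    unfolding root_poly_def zs[symmetric] by (simp add: prod_mset_prod_list flip: mset_map)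
  thus ?thesis using A that by simp
qed

text \<open>From left to right the polynomial is the monic one with roots \<open>zs\<close>. From
  right to left the list consists of all roots of \<open>p\<close> with multiplicity, and its monic
  polynomial is \<open>p\<close> divided by the leading coefficient.\<close>

lemma algebraic_over_iff_root:
  fixes z :: "'a::{field_char_0,alg_closed_field}"
  assumes F: "is_subfield F"
  shows "algebraic_over F z \<longleftrightarrow> (\<exists>p\<in>polys_over F. p \<noteq> 0 \<and> poly p z = 0)"
proof safe
  assume "algebraic_over F z"
  then obtain zs where zs: "z \<in> set zs" "\<forall>k. newton_sum k zs \<in> F"
    by (auto simp: algebraic_over_def)
  have "root_poly zs \<in> polys_over F"
    using coeffs_in_subfield_iff[OF F, of zs] zs by (auto simp: polys_over_def)
  moreover have "root_poly zs \<noteq> 0" using monic_root_poly[of zs] by auto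
  ultimately show "\<exists>p\<in>polys_over F. p \<noteq> 0 \<and> poly p z = 0"
    using zs(1) poly_root_poly_eq_0_iff by blast
next
  fix p assume p: "p \<in> polys_over F" "p \<noteq> 0" "poly p z = 0"
  obtain zs where p_eq: "p = smult (lead_coeff p) (root_poly zs)"
    using splits_root_poly[OF p(2)] .
  hence "coeff (root_poly zs) k = coeff p k / lead_coeff p" for k
    using p(2) by (metis coeff_smult leading_coeff_0_iff nonzero_mult_div_cancel_left)
  hence "\<forall>k. coeff (root_poly zs) k \<in> F"
    using p(1) by (auto simp: polys_over_def intro: is_subfieldD[OF F])
  moreover have "poly (root_poly zs) z = 0"
    using p(2,3) p_eq by (metis leading_coeff_0_iff mult_eq_0_iff poly_smult)
  ultimately show "algebraic_over F z"
    using coeffs_in_subfield_iff[OF F, of zs] poly_root_poly_eq_0_iff[of zs z]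
    by (auto simp: algebraic_over_def)
qed

section \<open>The fundamental theorem of algebra over a real closed field\<close>

definition imag_unit :: "'a::field alg_closure" where
  "imag_unit = (SOME i. i ^ 2 = - 1)"

lemma imag_unit_sq [simp]: "imag_unit * imag_unit = - 1"
proof -
  obtain i :: "'a alg_closure" where "i ^ 2 = - 1"
    using nth_root_exists[of 2 "-1"] by auto
  hence "imag_unit ^ 2 = (- 1 :: 'a alg_closure)"
    unfolding imag_unit_def by (rule someI)
  thus ?thesis by (simp add: power2_eq_square)
qed

definition gauss :: "'a::field \<Rightarrow> 'a \<Rightarrow> 'a alg_closure" where
  "gauss a b = to_ac a + imag_unit * to_ac b"

text \<open>The field R(i), formed inside the algebraic closure of R. The roots of a real polynomial
  exist there beforehand, and it remains only to show that one of them lies in this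
  subfield.\<close>

definition gauss_field :: "'a::field alg_closure set" where
  "gauss_field = {gauss a b | a b. True}"

lemma gauss_in_gauss_field [simp]: "gauss a b \<in> gauss_field"
  unfolding gauss_field_def by blast

lemma gauss_arith:
  "gauss a b + gauss c d = gauss (a + c) (b + d)"
  "gauss a b - gauss c d = gauss (a - c) (b - d)"
  "gauss a b * gauss c d = gauss (a * c - b * d) (a * d + b * c)"
proof -
  have "gauss a b * gauss c d = to_ac a * to_ac c + (imag_unit * imag_unit) * (to_ac b * to_ac d)
      + imag_unit * (to_ac a * to_ac d + to_ac b * to_ac c)"
    by (simp add: gauss_def algebra_simps del: imag_unit_sq)
  thus "gauss a b * gauss c d = gauss (a * c - b * d) (a * d + b * c)"
    by (simp add: gauss_def)
qed (simp_all add: gauss_def algebra_simps)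

lemma to_ac_eq_gauss: "to_ac a = gauss a 0"
  by (simp add: gauss_def)

text \<open>Multiplying by the conjugate gives a^2 + b^2, and in an ordered field a sum of two
  squares vanishes only trivially.\<close>

lemma gauss_eq_0_iff: "gauss (a :: 'a :: linordered_field) b = 0 \<longleftrightarrow> a = 0 \<and> b = 0"
proof
  assume "gauss a b = 0"
  hence "gauss a b * gauss a (- b) = 0" by simp
  hence "to_ac (a\<^sup>2 + b\<^sup>2) = 0"
    by (simp add: gauss_arith to_ac_eq_gauss power2_eq_square mult.commute del: to_ac_add)
  hence "a\<^sup>2 + b\<^sup>2 = 0" by (simp del: to_ac_add)
  thus "a = 0 \<and> b = 0" by (simp add: sum_power2_eq_zero_iff)
qed (simp add: gauss_def)

lemma is_subfield_gauss_field: "is_subfield (gauss_field :: 'a::linordered_field alg_closure set)"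
  unfolding is_subfield_def is_subring_def
proof (intro conjI ballI)
  have "1 = gauss (1::'a) 0" by (simp add: gauss_def)
  thus "1 \<in> (gauss_field :: 'a alg_closure set)" by (metis gauss_in_gauss_field)
next
  fix x y :: "'a alg_closure" assume "x \<in> gauss_field" "y \<in> gauss_field"
  thus "x - y \<in> gauss_field" "x * y \<in> gauss_field"
    unfolding gauss_field_def mem_Collect_eq gauss_arith by (metis gauss_arith(2), metis gauss_arith(3))
next
  fix x :: "'a alg_closure" assume "x \<in> gauss_field"
  then obtain a b where x: "x = gauss a b" by (auto simp: gauss_field_def)
  show "inverse x \<in> gauss_field"
  proof (cases "x = 0")
    case True
    hence "inverse x = gauss a b" using x by simp
    thus ?thesis by simp
  next
    case False
    define n where "n = a\<^sup>2 + b\<^sup>2"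
    have n: "n \<noteq> 0" using False x by (auto simp: gauss_eq_0_iff n_def sum_power2_eq_zero_iff)
    have "x * gauss (a / n) (- b / n) = gauss ((a * a + b * b) / n) 0"
      by (simp add: x gauss_arith mult.commute flip: add_divide_distrib)
    also have "(a * a + b * b) / n = 1" using n by (simp add: n_def power2_eq_square)
    also have "gauss 1 0 = 1" by (simp add: gauss_def)
    finally have "inverse x = gauss (a / n) (- b / n)" by (rule inverse_unique)
    thus ?thesis by simp
  qed
qed

lemma real_closed_sqrt:
  fixes a :: "'a::real_closed_field"
  assumes "0 \<le> a"
  obtains s where "0 \<le> s" "s * s = a"
proof -
  obtain y where "y * y = a" using nonneg_is_square[OF assms] by blast
  hence "\<bar>y\<bar> * \<bar>y\<bar> = a" by simp
  thus ?thesis using that[of "\<bar>y\<bar>"] by simp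
qed

text \<open>The half-angle formulas: if s is the absolute value of a + ib, the root has real part c
  with c^2 = (s + a)/2 and imaginary part with square (s - a)/2. Both radicands are nonnegative
  because |a| <= s, and the sign of the imaginary part is chosen so that 2 c d' = b.\<close>

lemma gauss_field_sqrt:
  fixes x :: "'a::real_closed_field alg_closure"
  assumes "x \<in> gauss_field"
  obtains y where "y \<in> gauss_field" "y * y = x"
proof -
  obtain a b where x: "x = gauss a b" using assms by (auto simp: gauss_field_def)
  obtain s where s: "0 \<le> s" "s * s = a * a + b * b"
    by (rule real_closed_sqrt[of "a * a + b * b"]) auto
  have "a * a \<le> s * s" using s by simp
  hence "\<bar>a\<bar> \<le> s" using s(1) by (metis abs_le_square_iff abs_of_nonneg power2_eq_square)
  hence pos: "0 \<le> (s + a) / 2" "0 \<le> (s - a) / 2" by auto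
  obtain c where c: "0 \<le> c" "c * c = (s + a) / 2" using real_closed_sqrt[OF pos(1)] .
  obtain d where d: "0 \<le> d" "d * d = (s - a) / 2" using real_closed_sqrt[OF pos(2)] .
  have "(2 * c * d) * (2 * c * d) = 4 * ((c * c) * (d * d))" by (simp add: mult_ac)
  also have "\<dots> = b * b" unfolding c d using s by (simp add: field_simps)
  finally have "2 * c * d = \<bar>b\<bar>"
    using c(1) d(1) by (metis abs_mult_self_eq abs_of_nonneg mult_nonneg_nonneg power2_eq_imp_eq power2_eq_square abs_ge_zero zero_le_numeral)
  then consider "2 * c * d = b" | "2 * c * (- d) = b" by (cases "b \<ge> 0") auto
  then obtain d' where d': "d' * d' = (s - a) / 2" "2 * c * d' = b"
  proof cases
    case 1
    thus ?thesis using that[of d] d by simp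
  next
    case 2
    thus ?thesis using that[of "- d"] d by simp
  qed
  have "gauss c d' * gauss c d' = gauss ((s + a) / 2 - (s - a) / 2) (2 * c * d')"
    unfolding c(2)[symmetric] d'(1)[symmetric] by (simp add: gauss_arith mult_ac)
  also have "\<dots> = x" unfolding d'(2) by (simp add: x field_simps)
  finally show ?thesis using that[of "gauss c d'"] by simp
qed

text \<open>The quadratic formula: the discriminant (z - w)^2 is a polynomial in z + w and z w, so
  it has a square root in R(i), and z is half the sum of z + w and z - w.\<close>

lemma gauss_field_quadratic:
  fixes z w :: "'a::real_closed_field alg_closure"
  assumes "z + w \<in> gauss_field" "z * w \<in> gauss_field"
  shows "z \<in> gauss_field"
proof -
  note F = is_subfield_gauss_field[where ?'a = 'a]
  have n: "of_nat k \<in> (gauss_field :: 'a alg_closure set)" for k by (rule is_subfield_of_nat[OF F])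
  have "(z - w) * (z - w) = (z + w) * (z + w) - of_nat 4 * (z * w)" by (simp add: algebra_simps)
  also have "\<dots> \<in> gauss_field" by (intro is_subfieldD[OF F] n assms)
  finally obtain y where y: "y \<in> gauss_field" "y * y = (z - w) * (z - w)"
    using gauss_field_sqrt by blast
  hence "y = z - w \<or> y = - (z - w)" by (metis square_eq_iff)
  hence "z - w \<in> gauss_field" using y(1) is_subfield_minus[OF F] by fastforce
  hence "((z + w) + (z - w)) / of_nat 2 \<in> gauss_field"
    using is_subfield_divide[OF F is_subfield_add[OF F assms(1)] n] by blast
  thus ?thesis by simp
qed

section \<open>Transfer of subfields and polynomials to the algebraic closure\<close>

lemma is_subfield_to_ac:
  fixes K :: "'a::field set"
  assumes "is_subfield K"
  shows "is_subfield (to_ac ` K)"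
  unfolding is_subfield_def is_subring_def
proof (intro conjI ballI)
  show "1 \<in> to_ac ` K" using is_subfield_1[OF assms] by (force simp flip: to_ac_1)
next
  fix x y assume "x \<in> to_ac ` K" "y \<in> to_ac ` K"
  thus "x - y \<in> to_ac ` K" "x * y \<in> to_ac ` K"
    using is_subfieldD[OF assms]
    by (auto simp del: to_ac_diff to_ac_mult simp flip: to_ac_diff to_ac_mult)
next
  fix x assume "x \<in> to_ac ` K"
  thus "inverse x \<in> to_ac ` K"
    using is_subfieldD[OF assms]
    by (auto simp del: to_ac_inverse simp flip: to_ac_inverse)
qed

lemma polys_over_to_ac:
  assumes "p \<in> polys_over (to_ac ` K)" "0 \<in> K"
  obtains q where "q \<in> polys_over K" "p = map_poly to_ac q"
proof
  show "map_poly of_ac p \<in> polys_over K"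
    using assms by (auto simp: polys_over_def coeff_map_poly image_iff) (metis of_ac_to_ac)
  show "p = map_poly to_ac (map_poly of_ac p)"
  proof (rule poly_eqI)
    fix n
    have "coeff p n \<in> range to_ac" using assms by (auto simp: polys_over_def)
    thus "coeff p n = coeff (map_poly to_ac (map_poly of_ac p)) n"
      by (simp add: coeff_map_poly to_ac_of_ac)
  qed
qed

lemma poly_map_poly_to_ac: "poly (map_poly to_ac p) (to_ac x) = to_ac (poly p x)"
  by (induction p) (auto simp: map_poly_pCons)

lemma odd_degree_imp_root:
  fixes p :: "'a::real_closed_field poly"
  assumes "odd (degree p)"
  shows "\<exists>x. poly p x = 0"
proof -
  have "lead_coeff p \<noteq> 0" using assms by (cases "p = 0") auto
  from odd_degree_root[where f = "coeff p", OF assms this] show ?thesis by (simp add: poly_altdef)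
qed

section \<open>Laplace's induction on the power of 2 in the degree\<close>

primrec pairs_list :: "('a \<Rightarrow> 'a \<Rightarrow> 'b) \<Rightarrow> 'a list \<Rightarrow> 'b list" where
  "pairs_list f [] = []"
| "pairs_list f (x # xs) = map (f x) xs @ pairs_list f xs"

text \<open>The number of pairs of positions i < j is n(n-1)/2; this form avoids division and
  truncated subtraction.\<close>

lemma length_pairs_list: "2 * length (pairs_list f xs) + length xs = length xs * length xs"
  by (induction xs) auto

lemma set_pairs_list: "set (pairs_list f xs) \<subseteq> {f x y | x y. x \<in> set xs \<and> y \<in> set xs}"
  by (induction xs) fastforce+

text \<open>Expanding the square of a Newton sum gives the diagonal terms, a Newton sum of double
  exponent, and every pair i < j twice. Dividing by 2 shows that the pair products again have their
  Newton sums in the subfield.\<close>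

lemma newton_sum_pairs_list:
  fixes f :: "'a::comm_ring_1 \<Rightarrow> 'a"
  shows "2 * newton_sum k (pairs_list (\<lambda>x y. f x * f y) xs) + newton_sum (2 * k) (map f xs)
    = newton_sum k (map f xs) * newton_sum k (map f xs)"
proof (induction xs)
  case (Cons x xs)
  have 1: "newton_sum k (map ((\<lambda>x y. f x * f y) x) xs) = f x ^ k * newton_sum k (map f xs)"
    by (simp add: newton_sum_def o_def power_mult_distrib sum_list_const_mult)
  have 2: "newton_sum k (us @ ws) = newton_sum k us + newton_sum k ws" for us ws :: "'a list"
    by (simp add: newton_sum_def)
  have 3: "newton_sum j (map f (x # xs)) = f x ^ j + newton_sum j (map f xs)" for j
    by (simp add: newton_sum_def)
  have 4: "f x ^ (2 * k) = f x ^ k * f x ^ k" by (simp add: power_add mult_2)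
  show ?case
    unfolding pairs_list.simps 1 2 3 4 using Cons.IH by (simp add: algebra_simps)
qed (simp add: newton_sum_def)

text \<open>Laplace's argument. For each natural number \<open>c\<close> the products \<open>(1 + c z\<^sub>i) (1 + c z\<^sub>j)\<close> with
  \<open>i < j\<close> again have real Newton sums, and their number contains one factor 2 less. Two values of \<open>c\<close>
  with the same pair put \<open>z\<^sub>i + z\<^sub>j\<close> and \<open>z\<^sub>i z\<^sub>j\<close> into \<open>R(i)\<close>.\<close>

theorem gauss_field_has_root:
  fixes zs :: "'a::real_closed_field alg_closure list"
  assumes "length zs = 2 ^ k * m" "odd m" "\<forall>j. newton_sum j zs \<in> range to_ac"
  shows "\<exists>z\<in>set zs. z \<in> gauss_field"
  using assms
proof (induction k arbitrary: zs m)
  case 0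
  note F = is_subfield_to_ac[of "UNIV :: 'a set"]
  have U: "is_subfield (UNIV :: 'a set)" by (simp add: is_subfield_def is_subring_def)
  have "root_poly zs \<in> polys_over (range to_ac)"
    using coeffs_in_subfield_iff[OF F[OF U]] 0 by (auto simp: polys_over_def)
  then obtain p where p: "root_poly zs = map_poly to_ac p"
    by (rule polys_over_to_ac) auto
  have "degree p = length zs"
    using monic_root_poly[of zs] by (simp add: p degree_map_poly)
  then obtain x where "poly p x = 0" using odd_degree_imp_root[of p] 0 by auto
  hence "poly (root_poly zs) (to_ac x) = 0" by (simp add: p poly_map_poly_to_ac)
  hence "to_ac x \<in> set zs" by (simp add: poly_root_poly_eq_0_iff)
  moreover have "to_ac x \<in> gauss_field" unfolding to_ac_eq_gauss by simp
  ultimately show ?case by blast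
next
  case (Suc k)
  note G = is_subfield_gauss_field[where ?'a = 'a]
  have "is_subfield (UNIV :: 'a set)" by (simp add: is_subfield_def is_subring_def)
  note F = is_subfield_to_ac[OF this]
  have ex: "\<exists>z\<in>set zs. \<exists>w\<in>set zs. (1 + of_nat c * z) * (1 + of_nat c * w) \<in> gauss_field" for c :: nat
  proof -
    define f where "f = (\<lambda>z :: 'a alg_closure. 1 + of_nat c * z)"
    define us where "us = pairs_list (\<lambda>z w. f z * f w) zs"
    have f: "newton_sum j (map f zs) \<in> range to_ac" for j
      unfolding f_def using Suc.prems
      by (intro newton_sum_in_subfield_map[OF F] is_subfield_of_nat[OF F] is_subfield_1[OF F])
    have "newton_sum j us \<in> range to_ac" for j
    proof -
      have "newton_sum j us = (newton_sum j (map f zs) * newton_sum j (map f zs)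
              - newton_sum (2 * j) (map f zs)) / of_nat 2"
        using newton_sum_pairs_list[of j f zs] by (simp add: us_def eq_divide_eq algebra_simps)
      also have "\<dots> \<in> range to_ac"
        by (intro is_subfieldD[OF F] f is_subfield_of_nat[OF F])
      finally show ?thesis .
    qed
    moreover have "length us = 2 ^ k * (m * (2 ^ Suc k * m - 1))"
    proof -
      have "2 * length us + 2 ^ Suc k * m = (2 ^ Suc k * m) * (2 ^ Suc k * m)"
        using length_pairs_list[of "\<lambda>z w. f z * f w" zs] Suc.prems(1) by (simp add: us_def)
      hence "2 * length us = (2 ^ Suc k * m) * (2 ^ Suc k * m - 1)"
        by (simp add: diff_mult_distrib2)
      thus ?thesis by (simp add: mult.assoc)
    qed
    \<comment> \<open>As m is odd it is nonzero, so the subtraction is not truncated and the second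
      factor is an odd predecessor of an even number.\<close>
    moreover have "odd (m * (2 ^ Suc k * m - 1))"
      using \<open>odd m\<close> by (cases m) auto
    ultimately obtain u where "u \<in> set us" "u \<in> gauss_field"
      using Suc.IH[of us] by blast
    moreover obtain z w where "u = f z * f w" "z \<in> set zs" "w \<in> set zs"
      using set_pairs_list[of "\<lambda>z w. f z * f w" zs] calculation(1) by (auto simp: us_def)
    ultimately show ?thesis unfolding f_def by blast
  qed
  \<comment> \<open>The shift to \<open>Suc c\<close> keeps the multiplier nonzero: for 0 the
    product is 1 and says nothing about z and w, and the multiplier is divided by below.\<close>
  hence "\<forall>c. \<exists>p\<in>set zs \<times> set zs. (1 + of_nat (Suc c) * fst p) * (1 + of_nat (Suc c) * snd p) \<in> gauss_field"
    by (metis fst_conv snd_conv mem_Times_iff)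
  then obtain g where g: "\<And>c. g c \<in> set zs \<times> set zs"
    "\<And>c. (1 + of_nat (Suc c) * fst (g c)) * (1 + of_nat (Suc c) * snd (g c)) \<in> gauss_field"
    by metis
  have "range g \<subseteq> set zs \<times> set zs" using g(1) by blast
  hence "finite (range g)" by (rule finite_subset) simp
  hence "\<not> inj g" using finite_imageD by blast
  then obtain c' d' where eq: "g c' = g d'" "c' \<noteq> d'" by (auto simp: inj_def)
  define z w where "z = fst (g c')" and "w = snd (g c')"
  define c d :: "'a alg_closure" where "c = of_nat (Suc c')" and "d = of_nat (Suc d')"
  have cd: "c \<noteq> 0" "d \<noteq> 0" "c - d \<noteq> 0" "c \<in> gauss_field" "d \<in> gauss_field"
    using eq(2) is_subfield_of_nat[OF G] by (simp_all add: c_def d_def del: of_nat_Suc)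
  have "(1 + c * z) * (1 + c * w) \<in> gauss_field" "(1 + d * z) * (1 + d * w) \<in> gauss_field"
    using g(2)[of c'] g(2)[of d'] eq(1) by (simp_all add: z_def w_def c_def d_def)
  hence "((1 + c * z) * (1 + c * w) - 1) / c \<in> gauss_field"
    "((1 + d * z) * (1 + d * w) - 1) / d \<in> gauss_field"
    using cd is_subfield_divide[OF G is_subfield_diff[OF G _ is_subfield_1[OF G]]] by blast+
  moreover have "((1 + c * z) * (1 + c * w) - 1) / c = (z + w) + c * (z * w)"
    using cd by (simp add: field_simps)
  moreover have "((1 + d * z) * (1 + d * w) - 1) / d = (z + w) + d * (z * w)"
    using cd by (simp add: field_simps)
  ultimately have lin: "(z + w) + c * (z * w) \<in> gauss_field" "(z + w) + d * (z * w) \<in> gauss_field"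
    by simp_all
  \<comment> \<open>Two linear combinations of z + w and z w are known. Their difference eliminates
    z + w, and c differs from d.\<close>
  hence "(((z + w) + c * (z * w)) - ((z + w) + d * (z * w))) / (c - d) \<in> gauss_field"
    using is_subfield_divide[OF G is_subfield_diff[OF G] is_subfield_diff[OF G cd(4,5)]] by blast
  also have "((z + w) + c * (z * w)) - ((z + w) + d * (z * w)) = (c - d) * (z * w)"
    by (simp add: algebra_simps)
  finally have prod: "z * w \<in> gauss_field" using cd by simp
  have "((z + w) + c * (z * w)) - c * (z * w) \<in> gauss_field"
    using is_subfield_diff[OF G lin(1) is_subfield_mult[OF G cd(4) prod]] .
  hence "z + w \<in> gauss_field" by simp
  hence "z \<in> gauss_field" using prod by (rule gauss_field_quadratic)
  thus ?case using g(1)[of c'] by (auto simp: z_def mem_Times_iff)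
qed

section \<open>Valuations on real closed fields\<close>

lemma zmult_simps [simp]:
  "zmult 0 g = 0" "zmult 1 g = g" "zmult (- k) g = - zmult k g"
  by (auto simp: zmult_def)

lemma zmult_plus_1: "zmult (k + 1) g = zmult k g + g"
proof (cases "k \<ge> 0")
  case True
  hence "nat (k + 1) = Suc (nat k)" "nat (- k) = 0" "nat (- (k + 1)) = 0" by auto
  thus ?thesis by (simp only: zmult_def sum.lessThan_Suc) simp
next
  case False
  hence "nat (- k) = Suc (nat (- (k + 1)))" "nat k = 0" "nat (k + 1) = 0" by auto
  thus ?thesis by (simp only: zmult_def sum.lessThan_Suc) simp
qed

lemma zmult_minus_1: "zmult (k - 1) g = zmult k g - g"
  using zmult_plus_1[of "k - 1" g] by simp

lemma zmult_add_left: "zmult (k + l) g = zmult k g + zmult l g"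
proof (induction l rule: int_induct[where k = 0])
  case (step1 i)
  then show ?case using zmult_plus_1[of "k + i" g] by (simp add: zmult_plus_1 add.assoc)
next
  case (step2 i)
  then show ?case using zmult_minus_1[of "k + i" g] by (simp add: zmult_minus_1 add.assoc add_diff_eq)
qed simp

lemma zmult_add_right: "zmult k (g + h) = zmult k g + zmult k h"
  by (simp add: zmult_def sum.distrib)

lemma zmult_minus_right: "zmult k (- g) = - zmult k g"
  by (simp add: zmult_def sum_negf)

lemma zmult_diff_right: "zmult k (g - h) = zmult k g - zmult k h"
  using zmult_add_right[of k g "- h"] by (simp add: zmult_minus_right)

lemma zmult_zmult: "zmult (k * l) g = zmult k (zmult l g)"
proof (induction k rule: int_induct[where k = 0])
  case (step1 i)
  then show ?case by (simp add: zmult_plus_1 zmult_add_left distrib_right)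
next
  case (step2 i)
  have "zmult ((i - 1) * l) g = zmult (i * l + (- l)) g" by (simp add: algebra_simps)
  then show ?case using step2 by (simp add: zmult_minus_1 zmult_add_left del: add_uminus_conv_diff)
qed simp

lemma zmult_pos:
  assumes "k > 0" "(g :: 'g :: linordered_ab_group_add) > 0"
  shows "zmult k g > 0"
  using assms(1)
proof (induction k rule: int_gr_induct)
  case base
  then show ?case using assms by simp
next
  case (step i)
  then show ?case using assms by (simp add: zmult_plus_1 add_pos_pos)
qed

lemma zmult_less:
  assumes "k > 0" "(g :: 'g :: linordered_ab_group_add) < h"
  shows "zmult k g < zmult k h"
  using zmult_pos[OF assms(1), of "h - g"] assms(2) by (simp add: zmult_diff_right)

lemma zmult_less_iff:
  assumes "k > 0"
  shows "zmult k (g :: 'g :: linordered_ab_group_add) < zmult k h \<longleftrightarrow> g < h"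
  using zmult_less[OF assms, of g h] zmult_less[OF assms, of h g]
  by (metis less_asym linorder_neqE)

lemma zmult_eq_iff:
  assumes "k > 0"
  shows "zmult k (g :: 'g :: linordered_ab_group_add) = zmult k h \<longleftrightarrow> g = h"
  using zmult_less[OF assms, of g h] zmult_less[OF assms, of h g]
  by (metis less_irrefl linorder_neqE)

text \<open>\<open>V\<close> is the valuation ring of the whole ambient field; the valuation of the
  subfield \<open>K\<close> is the restriction of \<open>v\<close>.\<close>

locale valuation =
  fixes V :: "'r::real_closed_field set"
    and v :: "'r \<Rightarrow> 'g::linordered_ab_group_add"
    and K :: "'r set"
  assumes ring: "is_subring V"
    and convex: "0 \<le> x \<Longrightarrow> 0 \<le> y \<Longrightarrow> x + y \<in> V \<Longrightarrow> x \<in> V"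
    and val: "valuation_of V v"
    and subfield: "is_subfield K"
begin

lemma v_mult: "x \<noteq> 0 \<Longrightarrow> y \<noteq> 0 \<Longrightarrow> v (x * y) = v x + v y"
  using val by (simp add: valuation_of_def)

lemma v_nonneg_iff: "x \<noteq> 0 \<Longrightarrow> 0 \<le> v x \<longleftrightarrow> x \<in> V"
  using val by (simp add: valuation_of_def)

lemma v_surj: obtains x where "x \<noteq> 0" "v x = g"
proof -
  have "g \<in> v ` (- {0})" using val by (simp add: valuation_of_def)
  thus ?thesis using that by auto
qed

lemma v_1 [simp]: "v 1 = 0"
  using v_mult[of 1 1] by simp

lemma v_minus [simp]: "v (- x) = v x"
proof (cases "x = 0")
  case False
  have "v (- 1) + v (- 1) = 0" using v_mult[of "-1" "-1"] by simp
  hence "v (- 1) = 0" by simp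
  thus ?thesis using v_mult[of "-1" x] False by simp
qed simp

lemma v_diff_commute: "v (x - y) = v (y - x)"
  using v_minus[of "x - y"] by simp

lemma v_divide: "x \<noteq> 0 \<Longrightarrow> y \<noteq> 0 \<Longrightarrow> v (x / y) = v x - v y"
  using v_mult[of "x / y" y] by (simp add: eq_diff_eq)

lemma v_power: "x \<noteq> 0 \<Longrightarrow> v (x ^ n) = zmult (int n) (v x)"
proof (induction n)
  case (Suc n)
  thus ?case using zmult_plus_1[of "int n" "v x"] by (simp add: v_mult add.commute)
qed simp

text \<open>Let v(x) <= v(y). Then y/x lies in \<open>V\<close>, hence so does (x + y)/x, which
  bounds v(x + y) from below. For the other bound x/(x + y) is one of two nonnegative summands of 1,
  so convexity puts it into \<open>V\<close>.\<close>

lemma v_add_pos: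
  assumes "0 < x" "0 < y"
  shows "v (x + y) = min (v x) (v y)"
proof -
  have *: "v (x + y) = v x" if xy: "0 < x" "0 < y" "v x \<le> v y" for x y
  proof -
    have "y / x \<in> V" using v_nonneg_iff[of "y / x"] v_divide[of y x] xy by simp
    \<comment> \<open>The sum 1 + y/x is written with differences because these are what
      \<open>is_subring\<close> provides.\<close>
    hence "1 - (0 - y / x) \<in> V" using ring unfolding is_subring_def by (metis diff_self)
    also have "1 - (0 - y / x) = (x + y) / x" using xy by (simp add: add_divide_distrib)
    finally have "v x \<le> v (x + y)"
      using v_nonneg_iff[of "(x + y) / x"] v_divide[of "x + y" x] xy by simp
    moreover have "x / (x + y) \<in> V"
    proof (rule convex)
      have "x / (x + y) + y / (x + y) = 1" using xy by (simp flip: add_divide_distrib)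
      thus "x / (x + y) + y / (x + y) \<in> V" using ring by (simp add: is_subring_def)
    qed (use xy in auto)
    hence "v (x + y) \<le> v x"
      using v_nonneg_iff[of "x / (x + y)"] v_divide[of x "x + y"] xy by simp
    ultimately show ?thesis by simp
  qed
  show ?thesis
    using *[OF assms] *[OF assms(2,1)] by (auto simp: min_def add.commute)
qed

lemma v_anti_mono: "0 < x \<Longrightarrow> x \<le> y \<Longrightarrow> v y \<le> v x"
  using v_add_pos[of x "y - x"] by (cases "x = y") auto

lemma v_sum_squares:
  assumes "x \<noteq> 0" "y \<noteq> 0"
  shows "v (x\<^sup>2 + y\<^sup>2) = min (v x) (v y) + min (v x) (v y)"
proof -
  have pos: "0 < x\<^sup>2" "0 < y\<^sup>2" using assms by simp_all
  have "v (x\<^sup>2 + y\<^sup>2) = min (v x + v x) (v y + v y)"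
    using assms v_add_pos[OF pos] v_mult[of x x] v_mult[of y y] by (simp add: power2_eq_square)
  also have "\<dots> = min (v x) (v y) + min (v x) (v y)"
    using add_mono[of "v x" "v y" "v x" "v y"] add_mono[of "v y" "v x" "v y" "v x"]
    by (cases "v x \<le> v y") (auto simp: min_absorb1 min_absorb2)
  finally show ?thesis .
qed

text \<open>Divisibility of the value group comes from k-th roots of positive elements. Even
  exponents are halved by a square root; for odd exponents X^k - x has a zero.\<close>

lemma v_root:
  assumes "k > 0"
  obtains g where "zmult (int k) g = (h :: 'g)"
proof -
  have root: "\<exists>y>0. y ^ k = x" if "x > 0" for x :: 'r
    using assms that
  proof (induction k arbitrary: x rule: less_induct)
    case (less k)
    show ?case
    proof (cases "even k")
      case True
      then obtain j where j: "k = 2 * j" "j < k" "j > 0" using less.prems by (auto elim!: evenE)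
      obtain s where s: "0 \<le> s" "s * s = x" using real_closed_sqrt[of x] less.prems by auto
      have "s > 0" using s less.prems by (cases "s = 0") auto
      then obtain y where "y > 0" "y ^ j = s" using less.IH[OF j(2,3)] by blast
      thus ?thesis using s j by (intro exI[of _ y]) (simp add: power_add mult_2)
    next
      case False
      \<comment> \<open>The coefficients of X^k - x.\<close>
      define f where "f = (\<lambda>i. if i = 0 then - x else if i = k then 1 else (0::'r))"
      have "f k \<noteq> 0" using less.prems by (simp add: f_def)
      from odd_degree_root[where f = f, OF False this]
      obtain y where "(\<Sum>i\<le>k. f i * y ^ i) = 0" by blast
      moreover have "(\<Sum>i\<le>k. f i * y ^ i) = (\<Sum>i\<in>{0, k}. f i * y ^ i)"
        by (rule sum.mono_neutral_right) (auto simp: f_def)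
      ultimately have y: "y ^ k = x" using less.prems by (simp add: f_def)
      hence "0 < y ^ k" using less.prems by simp
      hence "y > 0" using False by (auto simp: zero_less_power_eq)
      thus ?thesis using y by blast
    qed
  qed
  obtain x where x: "x \<noteq> 0" "v x = h" by (rule v_surj)
  then obtain y where "y > 0" "y ^ k = \<bar>x\<bar>" using root[of "\<bar>x\<bar>"] by auto
  hence "zmult (int k) (v y) = h" using v_power[of y k] x by (auto simp: abs_if split: if_splits)
  thus ?thesis using that by blast
qed

section \<open>The real closure and the divisible hull as ranges of end points and values\<close>

definition rc :: "'r set" where "rc = alg_closure_in K"
definition D :: "'g set" where "D = div_hull (value_group K v)"

lemma value_group_K:
  "0 \<in> value_group K v"
  "g \<in> value_group K v \<Longrightarrow> h \<in> value_group K v \<Longrightarrow> g - h \<in> value_group K v"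
proof -
  show "0 \<in> value_group K v"
    unfolding value_group_def using is_subfield_1[OF subfield] by (intro image_eqI[of _ _ 1]) auto
  assume "g \<in> value_group K v" "h \<in> value_group K v"
  then obtain x y where "x \<in> K" "y \<in> K" "x \<noteq> 0" "y \<noteq> 0" "g = v x" "h = v y"
    by (auto simp: value_group_def)
  thus "g - h \<in> value_group K v"
    unfolding value_group_def using is_subfield_divide[OF subfield]
    by (intro image_eqI[of _ _ "x / y"]) (auto simp: v_divide)
qed

lemma value_group_zmult: "g \<in> value_group K v \<Longrightarrow> zmult k g \<in> value_group K v"
proof (induction k rule: int_induct[where k = 0])
  case base
  show ?case using value_group_K by simp
next
  case (step1 i)
  have "zmult i g - (0 - g) \<in> value_group K v" using step1 by (intro value_group_K) auto
  thus ?case by (simp add: zmult_plus_1)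
next
  case (step2 i)
  thus ?case by (simp add: zmult_minus_1 value_group_K)
qed

lemma D_0: "0 \<in> D"
  using value_group_K(1) by (auto simp: D_def div_hull_def intro!: exI[of _ 1])

lemma D_diff: "g \<in> D \<Longrightarrow> h \<in> D \<Longrightarrow> g - h \<in> D"
proof -
  assume "g \<in> D" "h \<in> D"
  then obtain m n where mn: "m > 0" "n > 0" "zmult m g \<in> value_group K v" "zmult n h \<in> value_group K v"
    by (auto simp: D_def div_hull_def)
  have "zmult (m * n) (g - h) = zmult n (zmult m g) - zmult m (zmult n h)"
    by (simp add: zmult_diff_right flip: zmult_zmult add: mult.commute)
  also have "\<dots> \<in> value_group K v" by (intro value_group_K value_group_zmult mn)
  finally show ?thesis using mn unfolding D_def div_hull_def by (auto intro!: exI[of _ "m * n"])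
qed

lemma D_minus: "g \<in> D \<Longrightarrow> - g \<in> D"
  using D_diff[OF D_0, of g] by simp

lemma D_add: "g \<in> D \<Longrightarrow> h \<in> D \<Longrightarrow> g + h \<in> D"
  using D_diff[of g "- h"] D_minus[of h] by simp

lemma D_zmult: "g \<in> D \<Longrightarrow> zmult k g \<in> D"
proof (induction k rule: int_induct[where k = 0])
  case (step1 i)
  thus ?case by (simp add: zmult_plus_1 D_add)
next
  case (step2 i)
  thus ?case by (simp add: zmult_minus_1 D_diff)
qed (simp add: D_0)

lemma D_divisible: "n > 0 \<Longrightarrow> zmult n g \<in> D \<Longrightarrow> g \<in> D"
proof -
  assume n: "n > 0" "zmult n g \<in> D"
  then obtain m where "m > 0" "zmult (m * n) g \<in> value_group K v"
    by (auto simp: D_def div_hull_def zmult_zmult)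
  with n(1) show ?thesis unfolding D_def div_hull_def by (auto intro!: exI[of _ "m * n"])
qed

lemma v_K: "x \<in> K \<Longrightarrow> x \<noteq> 0 \<Longrightarrow> v x \<in> D"
  unfolding D_def div_hull_def value_group_def by (auto intro!: exI[of _ 1])

end

section \<open>Factorization of polynomials\<close>

lemma map_poly_to_ac_mult: "map_poly to_ac (p * q) = map_poly to_ac p * map_poly to_ac q"
  by (rule poly_eqI) (simp add: coeff_map_poly coeff_mult to_ac_sum)

lemma map_poly_to_ac_add: "map_poly to_ac (p + q) = map_poly to_ac p + map_poly to_ac q"
  by (rule poly_eqI) (simp add: coeff_map_poly)

lemma algebraic_over_base: "is_subfield F \<Longrightarrow> c \<in> F \<Longrightarrow> algebraic_over F c"
  unfolding algebraic_over_def
  by (intro exI[of _ "[c]"]) (simp add: newton_sum_def is_subfield_power)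

lemma polys_over_map_to_ac: "p \<in> polys_over K \<Longrightarrow> map_poly to_ac p \<in> polys_over (to_ac ` K)"
  by (simp add: polys_over_def coeff_map_poly)

lemma map_poly_to_ac_eq_0_iff: "map_poly to_ac p = 0 \<longleftrightarrow> p = 0"
  by (simp add: poly_eq_iff coeff_map_poly)

text \<open>The passage to the algebraic closure is made because
  \<open>algebraic_over_iff_root\<close> needs polynomials to split. A polynomial over the image of
  \<open>K\<close> comes from one over \<open>K\<close>, so no roots are gained or lost.\<close>

lemma alg_closure_in_iff:
  fixes K :: "'r::field_char_0 set"
  assumes K: "is_subfield K"
  shows "x \<in> alg_closure_in K \<longleftrightarrow> algebraic_over (to_ac ` K) (to_ac x)"
  unfolding algebraic_over_iff_root[OF is_subfield_to_ac[OF K]]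
proof
  assume "x \<in> alg_closure_in K"
  then obtain p where "p \<in> polys_over K" "p \<noteq> 0" "poly p x = 0" by (auto simp: alg_closure_in_def)
  thus "\<exists>p\<in>polys_over (to_ac ` K). p \<noteq> 0 \<and> poly p (to_ac x) = 0"
    by (intro bexI[of _ "map_poly to_ac p"])
      (simp_all add: polys_over_map_to_ac map_poly_to_ac_eq_0_iff poly_map_poly_to_ac)
next
  assume "\<exists>p\<in>polys_over (to_ac ` K). p \<noteq> 0 \<and> poly p (to_ac x) = 0"
  then obtain p where p: "p \<in> polys_over (to_ac ` K)" "p \<noteq> 0" "poly p (to_ac x) = 0" by blast
  obtain q where "q \<in> polys_over K" "p = map_poly to_ac q"
    using polys_over_to_ac[OF p(1) is_subfield_0[OF K]] .
  thus "x \<in> alg_closure_in K"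
    using p by (auto simp: alg_closure_in_def map_poly_to_ac_eq_0_iff poly_map_poly_to_ac)
qed

text \<open>Laplace's theorem is applied to the list of all roots. Its Newton sums are real because
  the coefficients are, and the multiplicity of 2 in the degree splits off the power required
  there.\<close>

lemma real_poly_root_gauss_field:
  fixes p :: "'r::real_closed_field poly"
  assumes "degree p > 0"
  obtains z where "z \<in> gauss_field" "poly (map_poly to_ac p) z = 0"
proof -
  have "p \<noteq> 0" using assms by auto
  define q where "q = map_poly to_ac p"
  have q: "q \<noteq> 0" "degree q = degree p"
    using \<open>p \<noteq> 0\<close> by (simp_all add: q_def map_poly_to_ac_eq_0_iff degree_map_poly)
  obtain zs where zs: "q = smult (lead_coeff q) (root_poly zs)"
    using splits_root_poly[OF q(1)] .
  have l: "lead_coeff q \<noteq> 0" using q(1) by (simp only: leading_coeff_0_iff not_False_eq_True)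
  have U: "is_subfield (UNIV :: 'r set)" by (simp add: is_subfield_def is_subring_def)
  note F = is_subfield_to_ac[OF this]
  have "coeff (root_poly zs) k = coeff q k / lead_coeff q" for k
    using l zs by (metis coeff_smult nonzero_mult_div_cancel_left)
  hence "\<forall>k. coeff (root_poly zs) k \<in> range to_ac"
    by (auto simp: q_def coeff_map_poly simp del: to_ac_divide simp flip: to_ac_divide)
  hence sums: "\<forall>k. newton_sum k zs \<in> range to_ac" using coeffs_in_subfield_iff[OF F] by blast
  have "degree q = degree (root_poly zs)" using l zs by (metis degree_smult_eq)
  hence len: "length zs = degree p" using q(2) monic_root_poly[of zs] by simp
  obtain m where m: "degree p = 2 ^ multiplicity 2 (degree p) * m" "\<not> 2 dvd m"
    using multiplicity_decompose'[of "degree p" 2] assms by auto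
  obtain z where "z \<in> set zs" "z \<in> gauss_field"
    using gauss_field_has_root[of zs "multiplicity 2 (degree p)" m] m sums len by auto
  moreover from this have "poly q z = 0"
    using zs poly_root_poly_eq_0_iff[of zs z] by (metis mult_zero_right poly_smult)
  ultimately show ?thesis using that by (simp add: q_def)
qed

text \<open>The divisor is the real polynomial with the conjugate roots a + ib and a - ib. The
  remainder c + dX vanishes at a + ib; its imaginary part gives bd = 0, hence d = 0, and the real
  part then gives c = 0.\<close>

lemma quadratic_dvd:
  fixes p :: "'r::linordered_field poly"
  assumes "b \<noteq> 0" "poly (map_poly to_ac p) (gauss a b) = 0"
  shows "[:a\<^sup>2 + b\<^sup>2, - 2 * a, 1:] dvd p"
proof -
  define q where "q = [:a\<^sup>2 + b\<^sup>2, - 2 * a, 1:]"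
  define r where "r = p mod q"
  have "q \<noteq> 0" "degree q = 2" by (simp_all add: q_def)
  hence "degree r < 2" using degree_mod_less'[of q p] by (cases "r = 0") (auto simp: r_def)
  hence "r = [:coeff r 0, coeff r 1:]"
    by (intro poly_eqI) (auto simp: coeff_pCons coeff_eq_0 split: nat.split)
  then obtain c d where r: "r = [:c, d:]" by blast
  have qz: "poly (map_poly to_ac q) (gauss a b) = 0"
  proof -
    have "poly (map_poly to_ac q) (gauss a b) =
      gauss (a\<^sup>2 + b\<^sup>2) 0 + gauss a b * (gauss (- 2 * a) 0 + gauss a b)"
      by (simp add: q_def map_poly_pCons to_ac_eq_gauss[symmetric] del: to_ac_add to_ac_mult to_ac_minus)
    also have "\<dots> = gauss 0 0" by (simp add: gauss_arith power2_eq_square)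
    finally show ?thesis by (simp add: gauss_def)
  qed
  have "poly (map_poly to_ac p) (gauss a b) =
      poly (map_poly to_ac q) (gauss a b) * poly (map_poly to_ac (p div q)) (gauss a b)
      + poly (map_poly to_ac r) (gauss a b)"
    unfolding poly_mult[symmetric] poly_add[symmetric] map_poly_to_ac_mult[symmetric]
      map_poly_to_ac_add[symmetric] r_def by simp
  hence "poly (map_poly to_ac r) (gauss a b) = 0" using qz assms by simp
  hence "gauss c 0 + gauss a b * gauss d 0 = 0"
    by (simp add: r map_poly_pCons to_ac_eq_gauss[symmetric])
  hence "c + a * d = 0" "b * d = 0" by (simp_all add: gauss_arith gauss_eq_0_iff)
  hence "r = 0" using assms by (simp add: r)
  thus ?thesis by (simp add: r_def q_def dvd_eq_mod_eq_0)
qed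

text \<open>Makes the conjugate a root as well, which is needed to obtain a as half the sum of two
  algebraic numbers.\<close>

lemma map_quadratic_conj:
  "poly (map_poly to_ac [:a\<^sup>2 + b\<^sup>2, - 2 * a, 1:]) (gauss a (- b)) = 0"
proof -
  have "poly (map_poly to_ac [:a\<^sup>2 + b\<^sup>2, - 2 * a, 1:]) (gauss a (- b)) =
      gauss (a\<^sup>2 + b\<^sup>2) 0 + gauss a (- b) * (gauss (- 2 * a) 0 + gauss a (- b))"
    by (simp add: map_poly_pCons to_ac_eq_gauss[symmetric] del: to_ac_add to_ac_mult to_ac_minus)
  also have "\<dots> = gauss 0 0" by (simp add: gauss_arith power2_eq_square)
  finally show ?thesis by (simp add: gauss_def)
qed

section \<open>Values of algebraic elements and splitting of polynomials over K\<close>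

context valuation
begin

lemma rc_iff: "x \<in> rc \<longleftrightarrow> algebraic_over (to_ac ` K) (to_ac x)"
  unfolding rc_def by (rule alg_closure_in_iff[OF subfield])

lemma K_subset_rc: "K \<subseteq> rc"
  by (auto simp: rc_iff intro!: algebraic_over_base is_subfield_to_ac subfield)

lemma rc_diff: "x \<in> rc \<Longrightarrow> y \<in> rc \<Longrightarrow> x - y \<in> rc"
proof -
  assume xy: "x \<in> rc" "y \<in> rc"
  note F = is_subfield_to_ac[OF subfield]
  have "algebraic_over (to_ac ` K) (- 1)"
    by (intro algebraic_over_base F is_subfieldD[OF F])
  hence "algebraic_over (to_ac ` K) (to_ac x + (- 1) * to_ac y)"
    using xy by (intro algebraic_over_add[OF F] algebraic_over_mult[OF F]) (auto simp: rc_iff)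
  thus "x - y \<in> rc" by (simp add: rc_iff)
qed

lemma v_sum_pos:
  assumes "finite I" "I \<noteq> {}" "\<And>i. i \<in> I \<Longrightarrow> 0 < t i"
  shows "\<exists>i\<in>I. v (sum t I) = v (t i)"
  using assms
proof (induction I rule: finite_ne_induct)
  case (insert i I)
  have "sum t I > 0" using insert by (intro sum_pos) auto
  hence "v (sum t (insert i I)) = min (v (t i)) (v (sum t I))"
    using insert by (simp add: v_add_pos)
  thus ?case using insert by (auto simp: min_def)
qed auto

text \<open>The positive and the negative terms have opposite sums, so neither kind is absent.
  Without cancellation each of the two partial sums has the value of one of its terms, and these two
  values agree.\<close>

lemma sum_eq_0_imp_equal_values:
  assumes "finite I" "I \<noteq> {}" "\<And>i. i \<in> I \<Longrightarrow> t i \<noteq> 0" "sum t I = 0"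
  obtains i j where "i \<in> I" "j \<in> I" "i \<noteq> j" "v (t i) = v (t j)"
proof -
  define P N where "P = {i\<in>I. t i > 0}" and "N = {i\<in>I. t i < 0}"
  have I: "I = P \<union> N"
    unfolding P_def N_def using assms(3) linorder_neqE by blast
  have PN: "finite P" "finite N" "P \<inter> N = {}"
    using assms(1) by (auto simp: P_def N_def)
  have eq: "sum t P = sum (\<lambda>i. - t i) N"
    using assms(4) PN by (simp add: I sum.union_disjoint sum_negf eq_neg_iff_add_eq_0)
  have "P \<noteq> {} \<and> N \<noteq> {}"
  proof (rule ccontr)
    assume "\<not> (P \<noteq> {} \<and> N \<noteq> {})"
    moreover have "P \<noteq> {} \<or> N \<noteq> {}" using I assms(2) by blast
    moreover have "P \<noteq> {} \<Longrightarrow> sum t P > 0" using PN by (intro sum_pos) (auto simp: P_def)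
    moreover have "N \<noteq> {} \<Longrightarrow> sum (\<lambda>i. - t i) N > 0" using PN by (intro sum_pos) (auto simp: N_def)
    ultimately show False using eq by (metis less_irrefl sum.empty)
  qed
  hence ne: "P \<noteq> {}" "N \<noteq> {}" by auto
  obtain i where i: "i \<in> P" "v (sum t P) = v (t i)"
    using v_sum_pos[OF PN(1) ne(1), of t] by (auto simp: P_def)
  obtain j where j: "j \<in> N" "v (sum (\<lambda>i. - t i) N) = v (t j)"
    using v_sum_pos[OF PN(2) ne(2), of "\<lambda>i. - t i"] by (auto simp: N_def)
  show ?thesis
  proof (rule that)
    show "i \<in> I" "j \<in> I" "i \<noteq> j" using i(1) j(1) by (auto simp: P_def N_def)
    show "v (t i) = v (t j)" using i(2) j(2) eq by simp
  qed
qed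

text \<open>Two monomials of degrees i < j in a relation p(x) = 0 have equal value, so (j - i) v(x)
  is a difference of values of coefficients in \<open>K\<close>.\<close>

lemma v_rc:
  assumes "x \<in> rc" "x \<noteq> 0"
  shows "v x \<in> D"
proof -
  obtain p where p: "p \<in> polys_over K" "p \<noteq> 0" "poly p x = 0"
    using assms by (auto simp: rc_def alg_closure_in_def)
  define t where "t = (\<lambda>i. coeff p i * x ^ i)"
  \<comment> \<open>Zero coefficients are dropped because the value at 0 is unspecified.\<close>
  define I where "I = {i. i \<le> degree p \<and> coeff p i \<noteq> 0}"
  have "sum t I = (\<Sum>i\<le>degree p. t i)"
    by (rule sum.mono_neutral_left) (auto simp: I_def t_def)
  also have "\<dots> = 0" using p(3) by (simp add: t_def poly_altdef)
  finally have "sum t I = 0" .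
  moreover have "degree p \<in> I" using p by (simp add: I_def)
  moreover have "finite I" by (simp add: I_def)
  moreover have "t i \<noteq> 0" if "i \<in> I" for i using that assms by (simp add: I_def t_def)
  ultimately obtain i j where ij: "i \<in> I" "j \<in> I" "i \<noteq> j" "v (t i) = v (t j)"
    using sum_eq_0_imp_equal_values[of I t] by blast
  have *: "v x \<in> D" if ij: "i \<in> I" "j \<in> I" "i < j" "v (t i) = v (t j)" for i j
  proof -
    have "v (coeff p i) + zmult (int i) (v x) = v (coeff p j) + zmult (int j) (v x)"
      using ij assms by (simp add: t_def I_def v_mult v_power)
    moreover have "zmult (int j) (v x) = zmult (int i) (v x) + zmult (int j - int i) (v x)"
      by (simp flip: zmult_add_left)
    ultimately have "zmult (int j - int i) (v x) = v (coeff p i) - v (coeff p j)"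
      by (simp add: algebra_simps)
    also have "\<dots> \<in> D" using ij p(1) by (intro D_diff v_K) (auto simp: I_def polys_over_def)
    finally show ?thesis using D_divisible[of "int j - int i" "v x"] ij(3) by simp
  qed
  show ?thesis using *[OF ij(1,2)] *[OF ij(2,1)] ij(3,4) by (metis linorder_neqE_nat)
qed

text \<open>The centers a become end points of intervals and must lie in \<open>rc\<close>. The
  constant and b matter only through their values, so only these are recorded to lie in
  \<open>D\<close>.\<close>

inductive splits :: "'r poly \<Rightarrow> bool" where
  const: "c \<noteq> 0 \<Longrightarrow> v c \<in> D \<Longrightarrow> splits [:c:]"
| linear: "a \<in> rc \<Longrightarrow> splits p \<Longrightarrow> splits ([:- a, 1:] * p)"
| quadratic: "a \<in> rc \<Longrightarrow> b \<noteq> 0 \<Longrightarrow> v b \<in> D \<Longrightarrow> splits p \<Longrightarrow>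
    splits ([:a\<^sup>2 + b\<^sup>2, - 2 * a, 1:] * p)"

text \<open>After a factor is removed the quotient need not have coefficients in \<open>K\<close>.
  The induction therefore carries two properties that do pass to quotients by monic factors: the
  roots are algebraic over \<open>K\<close>, and the leading coefficient has its value in
  \<open>D\<close>.\<close>

lemma splits_if_algebraic_roots:
  assumes "p \<noteq> 0" "v (lead_coeff p) \<in> D"
    "\<And>z. poly (map_poly to_ac p) z = 0 \<Longrightarrow> algebraic_over (to_ac ` K) z"
  shows "splits p"
  using assms
proof (induction "degree p" arbitrary: p rule: less_induct)
  case less
  note F = is_subfield_to_ac[OF subfield]
  show ?case
  proof (cases "degree p = 0")
    case True
    then obtain c where "p = [:c:]" by (metis degree_eq_zeroE)
    thus ?thesis using less.prems by (auto intro: splits.const)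
  next
    case False
    then obtain z where z: "z \<in> gauss_field" "poly (map_poly to_ac p) z = 0"
      using real_poly_root_gauss_field[of p] by auto
    then obtain a b where ab: "z = gauss a b" by (auto simp: gauss_field_def)
    have split_off: "splits q" if q: "p = s * q" "degree s > 0" "lead_coeff s = 1" for s q
    proof (rule less.hyps)
      have nz: "s \<noteq> 0" "q \<noteq> 0" using less.prems(1) q by auto
      show "degree q < degree p" using nz q by (simp add: degree_mult_eq)
      show "q \<noteq> 0" by fact
      show "v (lead_coeff q) \<in> D" using less.prems(2) q by (simp add: lead_coeff_mult)
      show "algebraic_over (to_ac ` K) z" if "poly (map_poly to_ac q) z = 0" for z
        using less.prems(3)[of z] that by (simp add: q(1) map_poly_to_ac_mult)
    qed
    show ?thesis
    proof (cases "b = 0")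
      case True
      hence z_eq: "z = to_ac a" by (simp add: ab to_ac_eq_gauss)
      hence "poly p a = 0" using z by (simp add: poly_map_poly_to_ac)
      then obtain q where q: "p = [:- a, 1:] * q" by (auto simp: poly_eq_0_iff_dvd)
      moreover have "a \<in> rc" using less.prems(3)[OF z(2)] by (simp add: rc_iff z_eq)
      moreover have "splits q" by (rule split_off[OF q]) auto
      ultimately show ?thesis by (auto intro: splits.linear simp del: mult_pCons_left)
    next
      case False
      have "[:a\<^sup>2 + b\<^sup>2, - 2 * a, 1:] dvd p"
        using False z(2) unfolding ab by (rule quadratic_dvd)
      then obtain q where q: "p = [:a\<^sup>2 + b\<^sup>2, - 2 * a, 1:] * q" ..
      have alg: "algebraic_over (to_ac ` K) z" using less.prems(3) z by blast
      have "poly (map_poly to_ac p) (gauss a (- b)) = 0"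
        unfolding q map_poly_to_ac_mult poly_mult map_quadratic_conj by simp
      hence alg': "algebraic_over (to_ac ` K) (gauss a (- b))" by (rule less.prems(3))
      \<comment> \<open>a is half the sum of the two conjugate roots.\<close>
      have "algebraic_over (to_ac ` K) ((z + gauss a (- b)) * (1 / of_nat 2))"
        by (intro algebraic_over_mult[OF F] algebraic_over_add[OF F] alg alg' algebraic_over_base[OF F]
              is_subfield_divide[OF F] is_subfield_1[OF F] is_subfield_of_nat[OF F])
      also have "(z + gauss a (- b)) * (1 / of_nat 2) = to_ac a"
        by (simp add: ab gauss_def)
      finally have a: "a \<in> rc" by (simp add: rc_iff)
      have i: "algebraic_over (to_ac ` K) imag_unit"
        unfolding algebraic_over_iff_root[OF F]
        by (intro bexI[of _ "[:1, 0, 1:]"])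
          (auto simp: polys_over_def coeff_pCons is_subfield_0[OF F] is_subfield_1[OF F] split: nat.splits)
      have m1: "algebraic_over (to_ac ` K) (- 1)"
        by (intro algebraic_over_base F is_subfieldD[OF F])
      \<comment> \<open>b = -i (z - a), and i is algebraic as a root of X^2 + 1.\<close>
      have "algebraic_over (to_ac ` K) (- 1 * (imag_unit * (z + - 1 * to_ac a)))"
        by (intro algebraic_over_mult[OF F] algebraic_over_add[OF F] i alg m1 a[unfolded rc_iff])
      also have "- 1 * (imag_unit * (z + - 1 * to_ac a)) = - ((imag_unit * imag_unit) * to_ac b)"
        by (simp add: ab gauss_def algebra_simps del: imag_unit_sq)
      also have "\<dots> = to_ac b" by simp
      finally have "b \<in> rc" by (simp add: rc_iff)
      hence "v b \<in> D" using False by (rule v_rc)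
      moreover have "splits q" by (rule split_off[OF q]) auto
      ultimately show ?thesis unfolding q using a False by (intro splits.quadratic)
    qed
  qed
qed

lemma splits_polys_over:
  assumes "p \<in> polys_over K" "p \<noteq> 0"
  shows "splits p"
proof (rule splits_if_algebraic_roots[OF assms(2)])
  show "v (lead_coeff p) \<in> D" using assms by (intro v_K) (auto simp: polys_over_def)
  show "algebraic_over (to_ac ` K) z" if "poly (map_poly to_ac p) z = 0" for z
    unfolding algebraic_over_iff_root[OF is_subfield_to_ac[OF subfield]]
    using assms that polys_over_map_to_ac map_poly_to_ac_eq_0_iff by blast
qed

end

section \<open>Piecewise linear functions and constructible sets\<close>

text \<open>The classes of this equivalence relation are the single points of \<open>E\<close> and
  the open gaps between them. Enlarging \<open>E\<close> refines the cells, so finitely many sets of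
  breakpoints can be merged by union.\<close>

definition same_cell :: "'g::linorder set \<Rightarrow> 'g \<Rightarrow> 'g \<Rightarrow> bool" where
  "same_cell E s t \<longleftrightarrow> (\<forall>e\<in>E. (s < e \<longleftrightarrow> t < e) \<and> (s = e \<longleftrightarrow> t = e))"

lemma same_cell_refl [simp]: "same_cell E s s"
  and same_cell_sym: "same_cell E s t \<Longrightarrow> same_cell E t s"
  and same_cell_trans: "same_cell E s t \<Longrightarrow> same_cell E t u \<Longrightarrow> same_cell E s u"
  and same_cell_mono: "same_cell E s t \<Longrightarrow> E' \<subseteq> E \<Longrightarrow> same_cell E' s t"
  and same_cell_Un: "same_cell (E \<union> F) s t \<longleftrightarrow> same_cell E s t \<and> same_cell F s t"
  by (auto simp: same_cell_def)

lemma sign_mult: "sign (x * y :: 'a :: linordered_field) = sign x * sign y"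
  by (auto simp: sign_def mult_less_0_iff zero_less_mult_iff)

lemma sign_eq_0_iff: "sign x = 0 \<longleftrightarrow> x = 0"
  by (auto simp: sign_def)

lemma sign_pos: "0 < x \<Longrightarrow> sign x = 1"
  by (auto simp: sign_def)

context valuation
begin

text \<open>Integer slopes, constants and breakpoints in \<open>D\<close>, no continuity. The
  variable s names a cell by a representative, and \<open>M\<close> lists the affine pieces, so that
  breakpoints can be collected piece by piece without enumerating the cells.\<close>

definition pl :: "('g \<Rightarrow> 'g) \<Rightarrow> bool" where
  "pl f \<longleftrightarrow> (\<exists>E M. finite E \<and> E \<subseteq> D \<and> finite M \<and> M \<subseteq> UNIV \<times> D \<and>
     (\<forall>s. \<exists>(k, \<gamma>)\<in>M. \<forall>t. same_cell E s t \<longrightarrow> f t = zmult k t + \<gamma>))"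

lemma plE:
  assumes "pl f"
  obtains E M where "finite E" "E \<subseteq> D" "finite M" "M \<subseteq> UNIV \<times> D"
    "\<forall>s. \<exists>k \<gamma>. (k, \<gamma>) \<in> M \<and> (\<forall>t. same_cell E s t \<longrightarrow> f t = zmult k t + \<gamma>)"
proof -
  obtain E M where EM: "finite E" "E \<subseteq> D" "finite M" "M \<subseteq> UNIV \<times> D"
     "\<And>s. \<exists>(k, \<gamma>)\<in>M. \<forall>t. same_cell E s t \<longrightarrow> f t = zmult k t + \<gamma>"
    using assms unfolding pl_def by blast
  have "\<exists>k \<gamma>. (k, \<gamma>) \<in> M \<and> (\<forall>t. same_cell E s t \<longrightarrow> f t = zmult k t + \<gamma>)" for s
    using EM(5)[of s] by (elim bexE) (auto split: prod.splits)
  thus ?thesis by (intro that[OF EM(1-4)]) blast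
qed

lemma plI:
  assumes "finite E" "E \<subseteq> D" "finite M" "M \<subseteq> UNIV \<times> D"
    "\<And>s. \<exists>k \<gamma>. (k, \<gamma>) \<in> M \<and> (\<forall>t. same_cell E s t \<longrightarrow> f t = zmult k t + \<gamma>)"
  shows "pl f"
  unfolding pl_def
proof (intro exI conjI allI)
  fix s
  show "\<exists>(k, \<gamma>)\<in>M. \<forall>t. same_cell E s t \<longrightarrow> f t = zmult k t + \<gamma>" using assms(5)[of s] by blast
qed (use assms(1-4) in auto)

lemma pl_const: "\<gamma> \<in> D \<Longrightarrow> pl (\<lambda>_. \<gamma>)"
  by (rule plI[of "{}" "{(0, \<gamma>)}"]) auto

lemma pl_id: "pl (\<lambda>t. t)"
  by (rule plI[of "{}" "{(1, 0)}"]) (auto simp: D_0)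

lemma pl_add:
  assumes "pl f" "pl g"
  shows "pl (\<lambda>t. f t + g t)"
proof -
  obtain E M where f: "finite E" "E \<subseteq> D" "finite M" "M \<subseteq> UNIV \<times> D"
    "\<forall>s. \<exists>k \<gamma>. (k, \<gamma>) \<in> M \<and> (\<forall>t. same_cell E s t \<longrightarrow> f t = zmult k t + \<gamma>)"
    using assms(1) by (rule plE)
  obtain E' M' where g: "finite E'" "E' \<subseteq> D" "finite M'" "M' \<subseteq> UNIV \<times> D"
    "\<forall>s. \<exists>k \<gamma>. (k, \<gamma>) \<in> M' \<and> (\<forall>t. same_cell E' s t \<longrightarrow> g t = zmult k t + \<gamma>)"
    using assms(2) by (rule plE)
  show ?thesis
  proof (rule plI[of "E \<union> E'" "(\<lambda>((k, \<gamma>), (k', \<gamma>')). (k + k', \<gamma> + \<gamma>')) ` (M \<times> M')"])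
    show "(\<lambda>((k, \<gamma>), (k', \<gamma>')). (k + k', \<gamma> + \<gamma>')) ` (M \<times> M') \<subseteq> UNIV \<times> D"
      using f(4) g(4) by (auto intro: D_add)
    fix s
    obtain k \<gamma> where 1: "(k, \<gamma>) \<in> M" "\<forall>t. same_cell E s t \<longrightarrow> f t = zmult k t + \<gamma>" using f(5) by blast
    obtain k' \<gamma>' where 2: "(k', \<gamma>') \<in> M'" "\<forall>t. same_cell E' s t \<longrightarrow> g t = zmult k' t + \<gamma>'" using g(5) by blast
    show "\<exists>l \<delta>. (l, \<delta>) \<in> (\<lambda>((k, \<gamma>), (k', \<gamma>')). (k + k', \<gamma> + \<gamma>')) ` (M \<times> M') \<and>
        (\<forall>t. same_cell (E \<union> E') s t \<longrightarrow> f t + g t = zmult l t + \<delta>)"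
    proof (intro exI conjI allI impI)
      show "(k + k', \<gamma> + \<gamma>') \<in> (\<lambda>((k, \<gamma>), (k', \<gamma>')). (k + k', \<gamma> + \<gamma>')) ` (M \<times> M')"
        using 1(1) 2(1) by force
      show "f t + g t = zmult (k + k') t + (\<gamma> + \<gamma>')" if "same_cell (E \<union> E') s t" for t
        using 1(2) 2(2) that by (simp add: same_cell_Un zmult_add_left ac_simps)
    qed
  qed (use f(1-4) g(1-4) in auto)
qed

lemma pl_zmult:
  assumes "pl f"
  shows "pl (\<lambda>t. zmult l (f t))"
proof -
  obtain E M where f: "finite E" "E \<subseteq> D" "finite M" "M \<subseteq> UNIV \<times> D"
    "\<forall>s. \<exists>k \<gamma>. (k, \<gamma>) \<in> M \<and> (\<forall>t. same_cell E s t \<longrightarrow> f t = zmult k t + \<gamma>)"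
    using assms(1) by (rule plE)
  show ?thesis
  proof (rule plI[of E "(\<lambda>(k, \<gamma>). (l * k, zmult l \<gamma>)) ` M"])
    show "(\<lambda>(k, \<gamma>). (l * k, zmult l \<gamma>)) ` M \<subseteq> UNIV \<times> D"
      using f(4) by (auto intro: D_zmult)
    fix s
    obtain k \<gamma> where 1: "(k, \<gamma>) \<in> M" "\<forall>t. same_cell E s t \<longrightarrow> f t = zmult k t + \<gamma>" using f(5) by blast
    show "\<exists>k \<gamma>. (k, \<gamma>) \<in> (\<lambda>(k, \<gamma>). (l * k, zmult l \<gamma>)) ` M \<and>
        (\<forall>t. same_cell E s t \<longrightarrow> zmult l (f t) = zmult k t + \<gamma>)"
    proof (intro exI conjI allI impI)
      show "(l * k, zmult l \<gamma>) \<in> (\<lambda>(k, \<gamma>). (l * k, zmult l \<gamma>)) ` M" using 1(1) by force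
      show "zmult l (f t) = zmult (l * k) t + zmult l \<gamma>" if "same_cell E s t" for t
        using 1(2) that by (simp add: zmult_zmult zmult_add_right)
    qed
  qed (use f(1-4) in auto)
qed

lemma pl_minus: "pl f \<Longrightarrow> pl (\<lambda>t. - f t)"
  using pl_zmult[of f "-1"] by simp

lemma pl_sum: "(\<And>i. i \<in> I \<Longrightarrow> pl (f i)) \<Longrightarrow> pl (\<lambda>t. \<Sum>i\<in>I. f i t)"
proof (induction I rule: infinite_finite_induct)
  case (insert i I)
  show ?case unfolding sum.insert[OF insert.hyps] by (intro pl_add insert.IH insert.prems) auto
qed (simp_all add: pl_const D_0)

text \<open>The sign changes only at h = -\<gamma>/k, which exists because the value group is
  divisible and lies in \<open>D\<close> because \<open>D\<close> is closed under division by
  integers. Negation reduces k < 0 to k > 0.\<close>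

lemma affine_sign:
  assumes "\<gamma> \<in> D" "k \<noteq> 0"
  obtains h where "h \<in> D" "\<And>s t. same_cell {h} s t \<Longrightarrow> sign (zmult k s + \<gamma>) = sign (zmult k t + \<gamma>)"
proof -
  have pos: "\<exists>h\<in>D. \<forall>s t. same_cell {h} s t \<longrightarrow> (zmult k s + \<gamma> < 0 \<longleftrightarrow> zmult k t + \<gamma> < 0) \<and>
      (zmult k s + \<gamma> = 0 \<longleftrightarrow> zmult k t + \<gamma> = 0)" if k: "\<gamma> \<in> D" "k > 0" for k \<gamma>
  proof -
    have "nat k > 0" using k by simp
    then obtain h where h: "zmult (int (nat k)) h = - \<gamma>" by (rule v_root)
    hence h': "zmult k h = - \<gamma>" using k by simp
    have "h \<in> D" using D_divisible[OF k(2), of h] D_minus[OF k(1)] h' by simp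
    moreover have "zmult k s + \<gamma> < 0 \<longleftrightarrow> s < h" "zmult k s + \<gamma> = 0 \<longleftrightarrow> s = h" for s
      using zmult_less_iff[OF k(2), of s h] zmult_eq_iff[OF k(2), of s h] h'
      by (simp_all add: less_minus_iff eq_neg_iff_add_eq_0 flip: less_diff_eq)
    ultimately show ?thesis by (intro bexI[of _ h]) (auto simp: same_cell_def)
  qed
  show ?thesis
  proof (cases "k > 0")
    case True
    then obtain h where h: "h \<in> D" "\<forall>s t. same_cell {h} s t \<longrightarrow> (zmult k s + \<gamma> < 0 \<longleftrightarrow> zmult k t + \<gamma> < 0) \<and>
      (zmult k s + \<gamma> = 0 \<longleftrightarrow> zmult k t + \<gamma> = 0)" using pos assms by blast
    show ?thesis by (rule that[OF h(1)]) (use h(2) in \<open>auto simp: sign_def\<close>)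
  next
    case False
    hence "- k > 0" using assms by simp
    with pos[OF D_minus[OF assms(1)] this] obtain h where h: "h \<in> D"
      "\<And>s t. same_cell {h} s t \<Longrightarrow> (- (zmult k s + \<gamma>) < 0 \<longleftrightarrow> - (zmult k t + \<gamma>) < 0) \<and>
      (- (zmult k s + \<gamma>) = 0 \<longleftrightarrow> - (zmult k t + \<gamma>) = 0)"
      by (auto simp: algebra_simps)
    have "sign (zmult k s + \<gamma>) = sign (zmult k t + \<gamma>)" if "same_cell {h} s t" for s t
      using h(2)[OF that] by (auto simp: sign_def simp del: minus_add_distrib)
    thus ?thesis by (rule that[OF h(1)])
  qed
qed

text \<open>The zeros of all nonconstant affine pieces are added to the breakpoints, whether or not
  a zero lies where its piece is active; constant pieces have constant sign.\<close>

lemma pl_sign: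
  assumes "pl f"
  obtains E where "finite E" "E \<subseteq> D" "\<forall>s t. same_cell E s t \<longrightarrow> sign (f s) = sign (f t)"
proof -
  obtain E M where f: "finite E" "E \<subseteq> D" "finite M" "M \<subseteq> UNIV \<times> D"
    "\<forall>s. \<exists>k \<gamma>. (k, \<gamma>) \<in> M \<and> (\<forall>t. same_cell E s t \<longrightarrow> f t = zmult k t + \<gamma>)"
    using assms(1) by (rule plE)
  have "\<forall>p\<in>M. \<exists>h. fst p \<noteq> 0 \<longrightarrow> h \<in> D \<and>
      (\<forall>s t. same_cell {h} s t \<longrightarrow> sign (zmult (fst p) s + snd p) = sign (zmult (fst p) t + snd p))"
  proof
    fix p assume "p \<in> M"
    hence "snd p \<in> D" using f(4) by auto
    thus "\<exists>h. fst p \<noteq> 0 \<longrightarrow> h \<in> D \<and>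
      (\<forall>s t. same_cell {h} s t \<longrightarrow> sign (zmult (fst p) s + snd p) = sign (zmult (fst p) t + snd p))"
      using affine_sign by metis
  qed
  then obtain r where r: "\<And>p. p \<in> M \<Longrightarrow> fst p \<noteq> 0 \<Longrightarrow> r p \<in> D \<and>
      (\<forall>s t. same_cell {r p} s t \<longrightarrow> sign (zmult (fst p) s + snd p) = sign (zmult (fst p) t + snd p))"
    by metis
  define E' where "E' = E \<union> r ` {p\<in>M. fst p \<noteq> 0}"
  have "sign (f s) = sign (f t)" if st: "same_cell E' s t" for s t
  proof -
    obtain k \<gamma> where k: "(k, \<gamma>) \<in> M" "\<forall>t. same_cell E s t \<longrightarrow> f t = zmult k t + \<gamma>" using f(5) by blast
    have "f s = zmult k s + \<gamma>" by (simp add: k(2))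
    moreover have "f t = zmult k t + \<gamma>" using st by (simp add: k(2) E'_def same_cell_Un)
    moreover have "sign (zmult k s + \<gamma>) = sign (zmult k t + \<gamma>)"
    proof (cases "k = 0")
      case False
      hence "r (k, \<gamma>) \<in> E'" using k(1) by (force simp: E'_def)
      hence "same_cell {r (k, \<gamma>)} s t" using st by (auto intro: same_cell_mono)
      thus ?thesis using r[OF k(1)] False by simp
    qed simp
    ultimately show ?thesis by simp
  qed
  moreover have "finite E'" "E' \<subseteq> D" using f(1-3) r by (auto simp: E'_def)
  ultimately show ?thesis by (intro that) blast+
qed

text \<open>After adding the breakpoints of the sign of f - g, the same one of the two functions is
  the smaller throughout each cell.\<close>

lemma pl_min:
  assumes "pl f" "pl g"
  shows "pl (\<lambda>t. min (f t) (g t))"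
proof -
  obtain E M where f: "finite E" "E \<subseteq> D" "finite M" "M \<subseteq> UNIV \<times> D"
    "\<forall>s. \<exists>k \<gamma>. (k, \<gamma>) \<in> M \<and> (\<forall>t. same_cell E s t \<longrightarrow> f t = zmult k t + \<gamma>)"
    using assms(1) by (rule plE)
  obtain E' M' where g: "finite E'" "E' \<subseteq> D" "finite M'" "M' \<subseteq> UNIV \<times> D"
    "\<forall>s. \<exists>k \<gamma>. (k, \<gamma>) \<in> M' \<and> (\<forall>t. same_cell E' s t \<longrightarrow> g t = zmult k t + \<gamma>)"
    using assms(2) by (rule plE)
  obtain F where F: "finite F" "F \<subseteq> D" "\<forall>s t. same_cell F s t \<longrightarrow> sign (f s + - g s) = sign (f t + - g t)"
    by (rule pl_sign[OF pl_add[OF assms(1) pl_minus[OF assms(2)]]])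
  have le: "f s \<le> g s \<longleftrightarrow> f t \<le> g t" if "same_cell F s t" for s t
    using F(3)[rule_format, OF that] by (auto simp: sign_def split: if_splits)
  show ?thesis
  proof (rule plI[of "E \<union> E' \<union> F" "M \<union> M'"])
    fix s
    obtain k \<gamma> where 1: "(k, \<gamma>) \<in> M" "\<forall>t. same_cell E s t \<longrightarrow> f t = zmult k t + \<gamma>" using f(5) by blast
    obtain k' \<gamma>' where 2: "(k', \<gamma>') \<in> M'" "\<forall>t. same_cell E' s t \<longrightarrow> g t = zmult k' t + \<gamma>'" using g(5) by blast
    show "\<exists>k \<gamma>. (k, \<gamma>) \<in> M \<union> M' \<and>
        (\<forall>t. same_cell (E \<union> E' \<union> F) s t \<longrightarrow> min (f t) (g t) = zmult k t + \<gamma>)"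
    proof (cases "f s \<le> g s")
      case True
      hence "min (f t) (g t) = zmult k t + \<gamma>" if "same_cell (E \<union> E' \<union> F) s t" for t
        using le[of s t] 1(2) that by (simp add: same_cell_Un min_def)
      thus ?thesis using 1(1) by blast
    next
      case False
      hence "min (f t) (g t) = zmult k' t + \<gamma>'" if "same_cell (E \<union> E' \<union> F) s t" for t
        using le[of s t] 2(2) that by (simp add: same_cell_Un min_def)
      thus ?thesis using 2(1) by blast
    qed
  qed (use f(1-4) g(1-4) F(1,2) in auto)
qed

text \<open>What a valued sign condition can see of g on a region: one constant sign and a piecewise
  linear value. The sign is required to be nonzero, so that \<open>v (g x)\<close> is never taken at
  0.\<close>

definition pl_on :: "'r set \<Rightarrow> ('r \<Rightarrow> 'g) \<Rightarrow> ('r \<Rightarrow> 'r) \<Rightarrow> bool" where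
  "pl_on Z \<tau> g \<longleftrightarrow> (\<exists>s. s \<noteq> 0 \<and> (\<forall>x\<in>Z. sign (g x) = s)) \<and> (\<exists>f. pl f \<and> (\<forall>x\<in>Z. v (g x) = f (\<tau> x)))"

lemma pl_onI:
  assumes "s \<noteq> 0" "\<And>x. x \<in> Z \<Longrightarrow> sign (g x) = s" "pl f" "\<And>x. x \<in> Z \<Longrightarrow> v (g x) = f (\<tau> x)"
  shows "pl_on Z \<tau> g"
  unfolding pl_on_def
proof (intro conjI)
  show "\<exists>s. s \<noteq> 0 \<and> (\<forall>x\<in>Z. sign (g x) = s)" using assms(1,2) by (intro exI[of _ s]) simp
  show "\<exists>f. pl f \<and> (\<forall>x\<in>Z. v (g x) = f (\<tau> x))" using assms(3,4) by (intro exI[of _ f]) simp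
qed

lemma pl_onE:
  assumes "pl_on Z \<tau> g"
  obtains s f where "s \<noteq> 0" "\<forall>x\<in>Z. sign (g x) = s" "pl f" "\<forall>x\<in>Z. v (g x) = f (\<tau> x)"
  using assms unfolding pl_on_def by (elim conjE exE) (rule that)

lemma pl_on_nonzero:
  assumes "pl_on Z \<tau> g" "x \<in> Z"
  shows "g x \<noteq> 0"
proof -
  obtain s where s: "s \<noteq> 0" "\<forall>x\<in>Z. sign (g x) = s" using assms(1) by (rule pl_onE)
  from s(2) assms(2) have "sign (g x) = s" ..
  thus ?thesis using s(1) sign_eq_0_iff[of "g x"] by simp
qed

lemma pl_on_mult:
  assumes "pl_on Z \<tau> g" "pl_on Z \<tau> h"
  shows "pl_on Z \<tau> (\<lambda>x. g x * h x)"
proof -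
  obtain s f where f: "s \<noteq> 0" "\<forall>x\<in>Z. sign (g x) = s" "pl f" "\<forall>x\<in>Z. v (g x) = f (\<tau> x)"
    using assms(1) by (rule pl_onE)
  obtain s' f' where f': "s' \<noteq> 0" "\<forall>x\<in>Z. sign (h x) = s'" "pl f'" "\<forall>x\<in>Z. v (h x) = f' (\<tau> x)"
    using assms(2) by (rule pl_onE)
  show ?thesis
  proof (rule pl_onI)
    show "s * s' \<noteq> 0" using f(1) f'(1) by simp
    show "pl (\<lambda>t. f t + f' t)" using f(3) f'(3) by (rule pl_add)
    fix x assume x: "x \<in> Z"
    show "sign (g x * h x) = s * s'" using f(2) f'(2) x by (simp add: sign_mult)
    show "v (g x * h x) = f (\<tau> x) + f' (\<tau> x)"
      using f(4) f'(4) x pl_on_nonzero[OF assms(1) x] pl_on_nonzero[OF assms(2) x] by (simp add: v_mult)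
  qed
qed

text \<open>The region \<open>Z\<close> is parametrized by \<open>\<tau>\<close> with values in the value group, in such a way that all
  \<open>v (x - a)\<close> are piecewise linear in \<open>\<tau> x\<close>.\<close>

definition adapted :: "'r set \<Rightarrow> 'r set \<Rightarrow> ('r \<Rightarrow> 'g) \<Rightarrow> bool" where
  "adapted A Z \<tau> \<longleftrightarrow> (\<forall>a\<in>A. pl_on Z \<tau> (\<lambda>x. x - a))"

lemma adapted_mono: "adapted A Z \<tau> \<Longrightarrow> B \<subseteq> A \<Longrightarrow> adapted B Z \<tau>"
  by (auto simp: adapted_def)

text \<open>\<open>A\<close> collects the centers a of all factors and does not depend on the
  region. A quadratic factor is a sum of squares with b nonzero, so it is positive and its value is
  twice a minimum of piecewise linear functions.\<close>

lemma splits_adapted: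
  assumes "splits p"
  shows "\<exists>A. finite A \<and> A \<subseteq> rc \<and> (\<forall>Z \<tau>. adapted A Z \<tau> \<longrightarrow> pl_on Z \<tau> (poly p))"
  using assms
proof induction
  case (const c)
  have "pl_on Z \<tau> (poly [:c:])" for Z \<tau>
  proof (rule pl_onI)
    show "sign c \<noteq> 0" using const(1) by (simp add: sign_eq_0_iff)
    show "pl (\<lambda>_. v c)" using const(2) by (rule pl_const)
  qed simp_all
  thus ?case by blast
next
  case (linear a p)
  then obtain A where A: "finite A" "A \<subseteq> rc" "\<And>Z \<tau>. adapted A Z \<tau> \<Longrightarrow> pl_on Z \<tau> (poly p)"
    by blast
  have eq: "poly ([:- a, 1:] * p) = (\<lambda>x. (x - a) * poly p x)" by (auto simp: algebra_simps)
  have "pl_on Z \<tau> (poly ([:- a, 1:] * p))" if "adapted (insert a A) Z \<tau>" for Z \<tau>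
    unfolding eq
  proof (rule pl_on_mult)
    show "pl_on Z \<tau> (\<lambda>x. x - a)" using that by (simp add: adapted_def)
    show "pl_on Z \<tau> (poly p)" using that by (intro A(3)) (rule adapted_mono, auto)
  qed
  moreover have "finite (insert a A)" "insert a A \<subseteq> rc" using A(1,2) linear(1) by auto
  ultimately show ?case by blast
next
  case (quadratic a b p)
  then obtain A where A: "finite A" "A \<subseteq> rc" "\<And>Z \<tau>. adapted A Z \<tau> \<Longrightarrow> pl_on Z \<tau> (poly p)"
    by blast
  have eq: "poly ([:a\<^sup>2 + b\<^sup>2, - 2 * a, 1:] * p) = (\<lambda>x. ((x - a)\<^sup>2 + b\<^sup>2) * poly p x)"
    by (auto simp: algebra_simps power2_eq_square)
  have "pl_on Z \<tau> (poly ([:a\<^sup>2 + b\<^sup>2, - 2 * a, 1:] * p))" if ad: "adapted (insert a A) Z \<tau>" for Z \<tau>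
    unfolding eq
  proof (rule pl_on_mult)
    show "pl_on Z \<tau> (poly p)" using ad by (intro A(3)) (rule adapted_mono, auto)
    have *: "pl_on Z \<tau> (\<lambda>x. x - a)" using ad by (simp add: adapted_def)
    then obtain h where h: "pl h" "\<forall>x\<in>Z. v (x - a) = h (\<tau> x)" by (rule pl_onE)
    show "pl_on Z \<tau> (\<lambda>x. (x - a)\<^sup>2 + b\<^sup>2)"
    proof (rule pl_onI)
      show "(1::int) \<noteq> 0" by simp
      show "sign ((x - a)\<^sup>2 + b\<^sup>2) = 1" for x
        using quadratic(2) by (intro sign_pos) (simp add: sum_power2_gt_zero_iff)
      show "pl (\<lambda>t. min (h t) (v b) + min (h t) (v b))"
        using h(1) quadratic(3) by (intro pl_add pl_min pl_const)
      show "v ((x - a)\<^sup>2 + b\<^sup>2) = min (h (\<tau> x)) (v b) + min (h (\<tau> x)) (v b)" if "x \<in> Z" for x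
        using v_sum_squares[of "x - a" b] pl_on_nonzero[OF * that] quadratic(2) h(2) that by simp
    qed
  qed
  moreover have "finite (insert a A)" "insert a A \<subseteq> rc" using A(1,2) quadratic(1) by auto
  ultimately show ?case by blast
qed

section \<open>Conditions whose truth depends only on the cell of the parameter\<close>

definition cellwise_on :: "'r set \<Rightarrow> ('r \<Rightarrow> 'g) \<Rightarrow> ('r \<Rightarrow> bool) \<Rightarrow> bool" where
  "cellwise_on Z \<tau> Q \<longleftrightarrow> (\<exists>E. finite E \<and> E \<subseteq> D \<and>
     (\<forall>x\<in>Z. \<forall>y\<in>Z. same_cell E (\<tau> x) (\<tau> y) \<longrightarrow> Q x = Q y))"

lemma cellwise_onI:
  assumes "finite E" "E \<subseteq> D" "\<And>x y. x \<in> Z \<Longrightarrow> y \<in> Z \<Longrightarrow> same_cell E (\<tau> x) (\<tau> y) \<Longrightarrow> Q x = Q y"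
  shows "cellwise_on Z \<tau> Q"
  unfolding cellwise_on_def
  by (intro exI[of _ E] conjI ballI impI assms)

lemma cellwise_on_const: "(\<And>x. x \<in> Z \<Longrightarrow> Q x = q) \<Longrightarrow> cellwise_on Z \<tau> Q"
  by (rule cellwise_onI[of "{}"]) simp_all

lemma cellwise_on_cong:
  assumes "cellwise_on Z \<tau> Q" "\<And>x. x \<in> Z \<Longrightarrow> Q x = Q' x"
  shows "cellwise_on Z \<tau> Q'"
  using assms(1) unfolding cellwise_on_def by (simp add: assms(2) cong: ball_cong_simp)

lemma cellwise_on_not: "cellwise_on Z \<tau> Q \<Longrightarrow> cellwise_on Z \<tau> (\<lambda>x. \<not> Q x)"
  by (simp add: cellwise_on_def)

lemma cellwise_on_Ball:
  assumes "finite I" "\<And>i. i \<in> I \<Longrightarrow> cellwise_on Z \<tau> (Q i)"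
  shows "cellwise_on Z \<tau> (\<lambda>x. \<forall>i\<in>I. Q i x)"
proof -
  obtain E where E: "\<And>i. i \<in> I \<Longrightarrow> finite (E i)" "\<And>i. i \<in> I \<Longrightarrow> E i \<subseteq> D"
    "\<And>i x y. i \<in> I \<Longrightarrow> x \<in> Z \<Longrightarrow> y \<in> Z \<Longrightarrow> same_cell (E i) (\<tau> x) (\<tau> y) \<Longrightarrow> Q i x = Q i y"
    using assms(2) unfolding cellwise_on_def by metis
  show ?thesis
  proof (rule cellwise_onI)
    show "finite (\<Union>i\<in>I. E i)" "(\<Union>i\<in>I. E i) \<subseteq> D" using assms(1) E(1,2) by auto
    fix x y assume xy: "x \<in> Z" "y \<in> Z" "same_cell (\<Union>i\<in>I. E i) (\<tau> x) (\<tau> y)"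
    have "same_cell (E i) (\<tau> x) (\<tau> y)" if "i \<in> I" for i
      using xy(3) by (rule same_cell_mono) (use that in blast)
    thus "(\<forall>i\<in>I. Q i x) = (\<forall>i\<in>I. Q i y)" using E(3)[OF _ xy(1,2)] by blast
  qed
qed

lemma cellwise_on_conj:
  assumes "cellwise_on Z \<tau> P" "cellwise_on Z \<tau> Q"
  shows "cellwise_on Z \<tau> (\<lambda>x. P x \<and> Q x)"
proof -
  have "cellwise_on Z \<tau> (\<lambda>x. \<forall>b\<in>UNIV. (if b then P else Q) x)"
    using assms by (intro cellwise_on_Ball) auto
  thus ?thesis by (simp add: all_bool_eq conj_commute)
qed

lemma vsc_cellwise:
  assumes C: "C \<in> vscs v m"
    and P: "\<And>j. j \<in> {1..m} \<Longrightarrow> (\<forall>x. P j x = 0) \<or> pl_on Z \<tau> (P j)"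
  shows "cellwise_on Z \<tau> (\<lambda>x. C (\<lambda>j. P j x))"
proof -
  obtain J \<sigma> L \<epsilon> where C_def: "C = vsc_holds v J \<sigma> L \<epsilon>" and J: "J \<subseteq> {1..m}" and L: "finite L"
    using C unfolding vscs_def by blast
  have "\<exists>s. \<forall>x\<in>Z. sign (P j x) = s" if "j \<in> J" for j
  proof -
    have "j \<in> {1..m}" using that J by blast
    from P[OF this] show ?thesis unfolding pl_on_def by auto
  qed
  then obtain s where s: "\<And>j x. j \<in> J \<Longrightarrow> x \<in> Z \<Longrightarrow> sign (P j x) = s j" by metis
  define J' where "J' = {j \<in> J. \<sigma> j \<noteq> 0}"
  show ?thesis
  proof (cases "\<forall>j\<in>J. s j = \<sigma> j")
    case False
    then obtain j where "j \<in> J" "s j \<noteq> \<sigma> j" by blast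
    hence "\<not> C (\<lambda>j. P j x)" if "x \<in> Z" for x
      using s[of j x] that by (auto simp: C_def vsc_holds_def)
    thus ?thesis by (intro cellwise_on_const[of _ _ False]) simp
  next
    case True
    have ex: "\<exists>f. pl f \<and> (\<forall>x\<in>Z. v (P j x) = f (\<tau> x))" if j: "j \<in> J'" for j
    \<comment> \<open>Only a point of the region can show that P j is not the zero polynomial; on
      the empty region any piecewise linear function will do.\<close>
    proof (cases "Z = {}")
      case True
      thus ?thesis using pl_id by blast
    next
      case False
      then obtain x where x: "x \<in> Z" by blast
      have "sign (P j x) = \<sigma> j" "\<sigma> j \<noteq> 0" using j s[OF _ x] True by (auto simp: J'_def)
      hence "P j x \<noteq> 0" by (metis sign_eq_0_iff)
      moreover have "j \<in> {1..m}" using j J by (auto simp: J'_def)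
      ultimately have "pl_on Z \<tau> (P j)" using P[of j] by blast
      thus ?thesis unfolding pl_on_def by blast
    qed
    obtain f where f: "\<And>j. j \<in> J' \<Longrightarrow> pl (f j)" "\<And>j x. j \<in> J' \<Longrightarrow> x \<in> Z \<Longrightarrow> v (P j x) = f j (\<tau> x)"
      using ex by metis
    have "cellwise_on Z \<tau> (\<lambda>x. sign (\<Sum>j\<in>J'. zmult (l j) (f j (\<tau> x))) = \<epsilon> l)" for l
    proof -
      have "pl (\<lambda>t. \<Sum>j\<in>J'. zmult (l j) (f j t))" by (intro pl_sum pl_zmult f)
      then obtain E where E: "finite E" "E \<subseteq> D" "\<forall>s t. same_cell E s t \<longrightarrow>
          sign (\<Sum>j\<in>J'. zmult (l j) (f j s)) = sign (\<Sum>j\<in>J'. zmult (l j) (f j t))"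
        by (rule pl_sign)
      show ?thesis by (rule cellwise_onI[OF E(1,2)]) (use E(3) in metis)
    qed
    hence "cellwise_on Z \<tau> (\<lambda>x. \<forall>l\<in>L. sign (\<Sum>j\<in>J'. zmult (l j) (f j (\<tau> x))) = \<epsilon> l)"
      using L by (intro cellwise_on_Ball)
    thus ?thesis
    proof (rule cellwise_on_cong)
      fix x assume "x \<in> Z"
      thus "(\<forall>l\<in>L. sign (\<Sum>j\<in>J'. zmult (l j) (f j (\<tau> x))) = \<epsilon> l) = C (\<lambda>j. P j x)"
        using True s f(2) unfolding C_def vsc_holds_def J'_def[symmetric] by simp
    qed
  qed
qed

text \<open>\<open>A\<close> is chosen before the region and the parameter. This makes the notion
  stable under boolean operations: for a conjunction the two sets are united.\<close>

definition cellwise :: "('r \<Rightarrow> bool) \<Rightarrow> bool" where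
  "cellwise Q \<longleftrightarrow> (\<exists>A. finite A \<and> A \<subseteq> rc \<and> (\<forall>Z \<tau>. adapted A Z \<tau> \<longrightarrow> cellwise_on Z \<tau> Q))"

lemma cellwise_not: "cellwise Q \<Longrightarrow> cellwise (\<lambda>x. \<not> Q x)"
  unfolding cellwise_def using cellwise_on_not by meson

lemma cellwise_conj:
  assumes "cellwise P" "cellwise Q"
  shows "cellwise (\<lambda>x. P x \<and> Q x)"
proof -
  obtain A where A: "finite A" "A \<subseteq> rc" "\<And>Z \<tau>. adapted A Z \<tau> \<Longrightarrow> cellwise_on Z \<tau> P"
    using assms(1) unfolding cellwise_def by blast
  obtain B where B: "finite B" "B \<subseteq> rc" "\<And>Z \<tau>. adapted B Z \<tau> \<Longrightarrow> cellwise_on Z \<tau> Q"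
    using assms(2) unfolding cellwise_def by blast
  have "cellwise_on Z \<tau> (\<lambda>x. P x \<and> Q x)" if "adapted (A \<union> B) Z \<tau>" for Z \<tau>
    using that by (intro cellwise_on_conj A(3) B(3)) (rule adapted_mono, auto)+
  thus ?thesis unfolding cellwise_def using A(1,2) B(1,2) by (intro exI[of _ "A \<union> B"] conjI allI impI) auto
qed

lemma basic_constructible_cellwise:
  assumes "basic_constructible K v S"
  shows "cellwise (\<lambda>x. x \<in> S)"
proof -
  obtain m P F where P: "\<forall>j\<in>{1..m}. P j \<in> polys_over K" and F: "finite F" "F \<subseteq> vscs v m"
    and S: "S = {x. \<forall>C\<in>F. C (\<lambda>j. poly (P j) x)}"
    using assms unfolding basic_constructible_def by blast
  have "\<exists>A. finite A \<and> A \<subseteq> rc \<and> (\<forall>Z \<tau>. adapted A Z \<tau> \<longrightarrow>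
      (\<forall>x. poly (P j) x = 0) \<or> pl_on Z \<tau> (poly (P j)))" if j: "j \<in> {1..m}" for j
  proof (cases "P j = 0")
    case True
    thus ?thesis by (intro exI[of _ "{}"]) simp
  next
    case False
    hence "splits (P j)" using P j splits_polys_over by blast
    from splits_adapted[OF this] show ?thesis by blast
  qed
  then obtain A where A: "\<And>j. j \<in> {1..m} \<Longrightarrow> finite (A j)" "\<And>j. j \<in> {1..m} \<Longrightarrow> A j \<subseteq> rc"
    "\<And>j Z \<tau>. j \<in> {1..m} \<Longrightarrow> adapted (A j) Z \<tau> \<Longrightarrow>
      (\<forall>x. poly (P j) x = 0) \<or> pl_on Z \<tau> (poly (P j))"
    by metis
  have "cellwise_on Z \<tau> (\<lambda>x. x \<in> S)" if ad: "adapted (\<Union>j\<in>{1..m}. A j) Z \<tau>" for Z \<tau>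
  proof -
    have Aj: "adapted (A j) Z \<tau>" if "j \<in> {1..m}" for j
      using ad by (rule adapted_mono) (use that in blast)
    have "cellwise_on Z \<tau> (\<lambda>x. C (\<lambda>j. poly (P j) x))" if "C \<in> F" for C
      using F(2) that A(3) Aj by (intro vsc_cellwise[where P = "\<lambda>j. poly (P j)"]) blast+
    hence "cellwise_on Z \<tau> (\<lambda>x. \<forall>C\<in>F. C (\<lambda>j. poly (P j) x))"
      using F(1) by (intro cellwise_on_Ball)
    thus ?thesis by (simp add: S)
  qed
  moreover have "finite (\<Union>j\<in>{1..m}. A j)" by (rule finite_UN_I) (use A(1) in auto)
  moreover have "(\<Union>j\<in>{1..m}. A j) \<subseteq> rc" by (rule UN_least) (rule A(2))
  ultimately show ?thesis unfolding cellwise_def by blast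
qed

lemma constructible_cellwise:
  assumes "constructible K v S"
  shows "cellwise (\<lambda>x. x \<in> S)"
  using assms
proof induction
  case (basic S)
  thus ?case by (rule basic_constructible_cellwise)
next
  case (compl S)
  thus ?case using cellwise_not[OF compl.IH] by simp
next
  case (union S T)
  thus ?case using cellwise_not[OF cellwise_conj[OF cellwise_not[OF union.IH(1)] cellwise_not[OF union.IH(2)]]]
    by simp
next
  case (inter S T)
  thus ?case using cellwise_conj[OF inter.IH] by simp
qed

end

section \<open>Decomposition into intervals\<close>

text \<open>\<alpha> is the largest breakpoint below s and \<beta> the smallest above, with infinite
  values if there is none. That \<alpha> dominates all breakpoints below s is recorded because it
  later yields 0 <= \<alpha> once 0 is a breakpoint.\<close>

lemma cell_interval:
  fixes E :: "'g::linorder set"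
  assumes "finite E" "s \<notin> E"
  obtains \<alpha> \<beta> where "\<alpha> \<in> Fin ` E \<union> {Minf}" "\<beta> \<in> Fin ` E \<union> {Pinf}" "\<alpha> < Fin s" "Fin s < \<beta>"
    "\<forall>e\<in>E. e < s \<longrightarrow> Fin e \<le> \<alpha>" "\<forall>t. same_cell E s t \<longleftrightarrow> \<alpha> < Fin t \<and> Fin t < \<beta>"
proof -
  have "\<exists>\<alpha>. \<alpha> \<in> Fin ` E \<union> {Minf} \<and> (\<forall>t. \<alpha> < Fin t \<longleftrightarrow> (\<forall>e\<in>E. e < s \<longrightarrow> e < t)) \<and>
      (\<forall>e\<in>E. e < s \<longrightarrow> Fin e \<le> \<alpha>)"
  proof (cases "{e\<in>E. e < s} = {}")
    case True
    thus ?thesis by (intro exI[of _ Minf]) auto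
  next
    case False
    define m where "m = Max {e\<in>E. e < s}"
    have fin: "finite {e\<in>E. e < s}" using assms(1) by simp
    have m: "m \<in> E" "m < s" using Max_in[OF fin False] by (simp_all add: m_def)
    have le: "e \<le> m" if "e \<in> E" "e < s" for e using Max_ge[OF fin, of e] that by (simp add: m_def)
    show ?thesis by (intro exI[of _ "Fin m"]) (use m le in \<open>auto intro: le_less_trans\<close>)
  qed
  then obtain \<alpha> where \<alpha>: "\<alpha> \<in> Fin ` E \<union> {Minf}" "\<And>t. \<alpha> < Fin t \<longleftrightarrow> (\<forall>e\<in>E. e < s \<longrightarrow> e < t)"
    "\<forall>e\<in>E. e < s \<longrightarrow> Fin e \<le> \<alpha>" by blast
  have "\<exists>\<beta>. \<beta> \<in> Fin ` E \<union> {Pinf} \<and> (\<forall>t. Fin t < \<beta> \<longleftrightarrow> (\<forall>e\<in>E. s < e \<longrightarrow> t < e))"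
  proof (cases "{e\<in>E. s < e} = {}")
    case True
    thus ?thesis by (intro exI[of _ Pinf]) auto
  next
    case False
    define m where "m = Min {e\<in>E. s < e}"
    have fin: "finite {e\<in>E. s < e}" using assms(1) by simp
    have m: "m \<in> E" "s < m" using Min_in[OF fin False] by (simp_all add: m_def)
    have le: "m \<le> e" if "e \<in> E" "s < e" for e using Min_le[OF fin, of e] that by (simp add: m_def)
    show ?thesis by (intro exI[of _ "Fin m"]) (use m le in \<open>auto intro: less_le_trans\<close>)
  qed
  then obtain \<beta> where \<beta>: "\<beta> \<in> Fin ` E \<union> {Pinf}" "\<And>t. Fin t < \<beta> \<longleftrightarrow> (\<forall>e\<in>E. s < e \<longrightarrow> t < e)"
    by blast
  have "same_cell E s t \<longleftrightarrow> \<alpha> < Fin t \<and> Fin t < \<beta>" for t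
  proof
    assume st: "same_cell E s t"
    have "e < t" if "e \<in> E" "e < s" for e
    proof -
      have "(s < e) = (t < e)" "(s = e) = (t = e)" using st that(1) by (simp_all add: same_cell_def)
      thus ?thesis using that(2) by (metis linorder_neqE order_less_asym)
    qed
    moreover have "t < e" if "e \<in> E" "s < e" for e using st that by (simp add: same_cell_def)
    ultimately show "\<alpha> < Fin t \<and> Fin t < \<beta>" unfolding \<alpha>(2) \<beta>(2) by simp
  next
    assume t: "\<alpha> < Fin t \<and> Fin t < \<beta>"
    hence t: "\<forall>e\<in>E. e < s \<longrightarrow> e < t" "\<forall>e\<in>E. s < e \<longrightarrow> t < e" unfolding \<alpha>(2) \<beta>(2) by simp_all
    show "same_cell E s t"
      unfolding same_cell_def
    proof
      fix e assume e: "e \<in> E"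
      hence "s \<noteq> e" using assms(2) by auto
      thus "(s < e) = (t < e) \<and> (s = e) = (t = e)"
        using t e by (cases s e rule: linorder_cases) auto
    qed
  qed
  moreover have "\<alpha> < Fin s" "Fin s < \<beta>" unfolding \<alpha>(2) \<beta>(2) by simp_all
  ultimately show ?thesis using \<alpha>(1,3) \<beta>(1) by (intro that[of \<alpha> \<beta>]) simp_all
qed

context valuation
begin

section \<open>Gluing of points and intervals\<close>

definition decomposable :: "'r set \<Rightarrow> bool" where
  "decomposable T \<longleftrightarrow> (\<exists>\<A>. finite \<A> \<and> disjoint \<A> \<and> \<Union>\<A> = T \<and>
     (\<forall>A\<in>\<A>. (\<exists>a\<in>alg_closure_in K. A = {a}) \<or> vo_interval K v A))"

lemma decomposableI:
  assumes "finite \<A>" "disjoint \<A>" "\<Union>\<A> = T"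
    "\<And>A. A \<in> \<A> \<Longrightarrow> (\<exists>a\<in>alg_closure_in K. A = {a}) \<or> vo_interval K v A"
  shows "decomposable T"
  unfolding decomposable_def by (intro exI[of _ \<A>] conjI ballI assms)

lemma decomposable_empty: "decomposable {}"
  by (rule decomposableI[of "{}"]) auto

lemma decomposable_Un:
  assumes "decomposable T" "decomposable Y" "T \<inter> Y = {}"
  shows "decomposable (T \<union> Y)"
proof -
  obtain \<A> where A: "finite \<A>" "disjoint \<A>" "\<Union>\<A> = T"
    "\<forall>A\<in>\<A>. (\<exists>a\<in>alg_closure_in K. A = {a}) \<or> vo_interval K v A"
    using assms(1) unfolding decomposable_def by blast
  obtain \<B> where B: "finite \<B>" "disjoint \<B>" "\<Union>\<B> = Y"
    "\<forall>A\<in>\<B>. (\<exists>a\<in>alg_closure_in K. A = {a}) \<or> vo_interval K v A"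
    using assms(2) unfolding decomposable_def by blast
  show ?thesis
  proof (rule decomposableI)
    show "finite (\<A> \<union> \<B>)" "\<Union>(\<A> \<union> \<B>) = T \<union> Y" using A(1,3) B(1,3) by auto
    show "disjoint (\<A> \<union> \<B>)" using A(2,3) B(2,3) assms(3) by (intro disjoint_union) auto
    show "(\<exists>a\<in>alg_closure_in K. A = {a}) \<or> vo_interval K v A" if "A \<in> \<A> \<union> \<B>" for A
      using that A(4) B(4) by (elim UnE) simp_all
  qed
qed

lemma decomposable_UN:
  assumes "finite I" "\<And>i. i \<in> I \<Longrightarrow> decomposable (T i)"
    "\<And>i j. i \<in> I \<Longrightarrow> j \<in> I \<Longrightarrow> i \<noteq> j \<Longrightarrow> T i \<inter> T j = {}"
  shows "decomposable (\<Union>i\<in>I. T i)"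
  using assms
proof (induction I rule: finite_induct)
  case empty
  show ?case by (simp add: decomposable_empty)
next
  case (insert i I)
  have "T i \<inter> T j = {}" if "j \<in> I" for j using insert.prems(2)[of i j] insert.hyps(2) that by auto
  hence "T i \<inter> (\<Union>j\<in>I. T j) = {}" by auto
  moreover have "decomposable (\<Union>j\<in>I. T j)" by (rule insert.IH) (use insert.prems in auto)
  moreover have "decomposable (T i)" using insert.prems(1) by simp
  ultimately have "decomposable (T i \<union> (\<Union>j\<in>I. T j))" by (intro decomposable_Un)
  thus ?case by simp
qed

lemma decomposable_finite:
  assumes "finite T" "T \<subseteq> rc"
  shows "decomposable T"
proof -
  have "decomposable (\<Union>x\<in>T. {x})"
  proof (rule decomposable_UN)
    show "decomposable {x}" if "x \<in> T" for x
      by (rule decomposableI[of "{{x}}"]) (use that assms(2) in \<open>auto simp: rc_def\<close>)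
  qed (use assms in auto)
  thus ?thesis by simp
qed

text \<open>\<open>E0\<close> is empty or \<open>{0}\<close>: the values \<open>0 < \<alpha>\<close> and \<open>0 \<le> \<alpha>\<close> required for the intervals between two
  points are enforced by making \<open>0\<close> a breakpoint.\<close>

lemma decomposable_region:
  assumes S: "cellwise_on Z \<tau> (\<lambda>x. x \<in> S)"
    and E0: "finite E0" "E0 \<subseteq> D" "\<And>e x. e \<in> E0 \<Longrightarrow> x \<in> Z \<Longrightarrow> e < \<tau> x"
    and point: "\<And>x. x \<in> Z \<Longrightarrow> \<tau> x \<in> D \<Longrightarrow> vo_interval K v {y\<in>Z. \<tau> y = \<tau> x}"
    and interval: "\<And>\<alpha> \<beta> x. x \<in> Z \<Longrightarrow> \<alpha> \<in> Fin ` D \<union> {Minf} \<Longrightarrow> \<beta> \<in> Fin ` D \<union> {Pinf} \<Longrightarrow>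
      \<alpha> < Fin (\<tau> x) \<Longrightarrow> Fin (\<tau> x) < \<beta> \<Longrightarrow> \<forall>e\<in>E0. Fin e \<le> \<alpha> \<Longrightarrow>
      vo_interval K v {y\<in>Z. \<alpha> < Fin (\<tau> y) \<and> Fin (\<tau> y) < \<beta>}"
  shows "decomposable (S \<inter> Z)"
proof -
  obtain E1 where E1: "finite E1" "E1 \<subseteq> D"
    "\<forall>x\<in>Z. \<forall>y\<in>Z. same_cell E1 (\<tau> x) (\<tau> y) \<longrightarrow> (x \<in> S) = (y \<in> S)"
    using S unfolding cellwise_on_def by (elim exE conjE)
  define E where "E = E1 \<union> E0"
  have E: "finite E" "E \<subseteq> D" using E1 E0 by (auto simp: E_def)
  have E_S: "(x \<in> S) = (y \<in> S)" if "x \<in> Z" "y \<in> Z" "same_cell E (\<tau> x) (\<tau> y)" for x y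
    using E1(3) that unfolding E_def same_cell_Un by blast
  \<comment> \<open>The pieces are the cells of points of S in the region. By \<open>E_S\<close>
    such a cell lies entirely in S, and none is empty.\<close>
  define cell where "cell = (\<lambda>x. {y\<in>Z. same_cell E (\<tau> x) (\<tau> y)})"
  show ?thesis
  proof (rule decomposableI)
    \<comment> \<open>A cell is determined by the set of breakpoints above the parameter and the set
      of those equal to it.\<close>
    show "finite (cell ` (S \<inter> Z))"
    proof (rule finite_subset)
      define g where "g = (\<lambda>(p, q). {y\<in>Z. {e\<in>E. \<tau> y < e} = p \<and> {e\<in>E. \<tau> y = e} = q})"
      have "cell x = g ({e\<in>E. \<tau> x < e}, {e\<in>E. \<tau> x = e})" for x
        unfolding cell_def g_def same_cell_def by auto
      thus "cell ` (S \<inter> Z) \<subseteq> g ` (Pow E \<times> Pow E)" by auto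
      show "finite (g ` (Pow E \<times> Pow E))" using E(1) by simp
    qed
    show "disjoint (cell ` (S \<inter> Z))"
    proof (rule disjointI)
      fix a b assume "a \<in> cell ` (S \<inter> Z)" "b \<in> cell ` (S \<inter> Z)" "a \<noteq> b"
      then obtain x y where xy: "a = cell x" "b = cell y" by auto
      show "a \<inter> b = {}"
      proof (rule ccontr)
        assume "a \<inter> b \<noteq> {}"
        then obtain z where "same_cell E (\<tau> x) (\<tau> z)" "same_cell E (\<tau> y) (\<tau> z)"
          by (auto simp: xy cell_def)
        hence "same_cell E (\<tau> x) (\<tau> y)" by (meson same_cell_sym same_cell_trans)
        hence "cell x = cell y" unfolding cell_def by (meson same_cell_sym same_cell_trans)
        thus False using \<open>a \<noteq> b\<close> xy by simp
      qed
    qed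
    show "\<Union>(cell ` (S \<inter> Z)) = S \<inter> Z"
    proof (intro equalityI subsetI)
      fix y assume "y \<in> \<Union>(cell ` (S \<inter> Z))"
      then obtain x where "x \<in> S" "x \<in> Z" "y \<in> Z" "same_cell E (\<tau> x) (\<tau> y)" by (auto simp: cell_def)
      thus "y \<in> S \<inter> Z" using E_S[of x y] by simp
    next
      fix y assume "y \<in> S \<inter> Z"
      moreover from this have "y \<in> cell y" by (simp add: cell_def)
      ultimately show "y \<in> \<Union>(cell ` (S \<inter> Z))" by blast
    qed
    fix A assume "A \<in> cell ` (S \<inter> Z)"
    then obtain x where x: "x \<in> Z" "A = cell x" by auto
    have "vo_interval K v (cell x)"
    proof (cases "\<tau> x \<in> E")
      case True
      hence "cell x = {y\<in>Z. \<tau> y = \<tau> x}" by (auto simp: cell_def same_cell_def)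
      thus ?thesis using point[OF x(1)] True E(2) by auto
    next
      case False
      obtain \<alpha> \<beta> where ab: "\<alpha> \<in> Fin ` E \<union> {Minf}" "\<beta> \<in> Fin ` E \<union> {Pinf}" "\<alpha> < Fin (\<tau> x)"
        "Fin (\<tau> x) < \<beta>" "\<forall>e\<in>E. e < \<tau> x \<longrightarrow> Fin e \<le> \<alpha>"
        "\<forall>t. same_cell E (\<tau> x) t \<longleftrightarrow> \<alpha> < Fin t \<and> Fin t < \<beta>"
        using E(1) False by (rule cell_interval)
      have "\<alpha> \<in> Fin ` D \<union> {Minf}" "\<beta> \<in> Fin ` D \<union> {Pinf}" using ab(1,2) E(2) by auto
      moreover have "\<forall>e\<in>E0. Fin e \<le> \<alpha>" using ab(5) E0(3)[OF _ x(1)] by (simp add: E_def)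
      ultimately have "vo_interval K v {y\<in>Z. \<alpha> < Fin (\<tau> y) \<and> Fin (\<tau> y) < \<beta>}"
        using interval[OF x(1)] ab(3,4) by simp
      thus ?thesis using ab(6) by (simp add: cell_def)
    qed
    thus "(\<exists>a\<in>alg_closure_in K. A = {a}) \<or> vo_interval K v A" by (simp add: x(2))
  qed
qed

text \<open>For c < a < x both differences in x - c = (x - a) + (a - c) are positive, so v(x - c) is
  the minimum of v(x - a) and a constant in \<open>D\<close>; similarly on the other side. Hence
  only the end points adjacent to the region have to be checked.\<close>

lemma adaptedI:
  assumes "A \<subseteq> rc"
    and sides: "\<And>c. c \<in> A \<Longrightarrow> (\<exists>a\<in>rc. c \<le> a \<and> pl_on Z \<tau> (\<lambda>x. x - a) \<and> (\<forall>x\<in>Z. a < x)) \<or>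
      (\<exists>b\<in>rc. b \<le> c \<and> pl_on Z \<tau> (\<lambda>x. x - b) \<and> (\<forall>x\<in>Z. x < b))"
  shows "adapted A Z \<tau>"
  unfolding adapted_def
proof
  fix c assume c: "c \<in> A"
  have "c \<in> rc" using c assms(1) by blast
  from sides[OF c] show "pl_on Z \<tau> (\<lambda>x. x - c)"
  proof (elim disjE bexE conjE)
    fix a assume a: "a \<in> rc" "c \<le> a" "pl_on Z \<tau> (\<lambda>x. x - a)" "\<forall>x\<in>Z. a < x"
    obtain h where h: "pl h" "\<forall>x\<in>Z. v (x - a) = h (\<tau> x)" using a(3) by (rule pl_onE)
    show ?thesis
    proof (cases "c = a")
      case True
      thus ?thesis using a(3) by simp
    next
      case False
      have "v (a - c) \<in> D" using False by (intro v_rc rc_diff a(1) \<open>c \<in> rc\<close>) simp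
      show ?thesis
      proof (rule pl_onI)
        show "(1::int) \<noteq> 0" by simp
        show "pl (\<lambda>t. min (h t) (v (a - c)))" by (intro pl_min pl_const h(1) \<open>v (a - c) \<in> D\<close>)
        fix x assume x: "x \<in> Z"
        show "sign (x - c) = 1" using a(2,4) x by (intro sign_pos) auto
        have "v ((x - a) + (a - c)) = min (v (x - a)) (v (a - c))"
          using a(2,4) x False by (intro v_add_pos) auto
        thus "v (x - c) = min (h (\<tau> x)) (v (a - c))" using h(2) x by simp
      qed
    qed
  next
    fix b assume b: "b \<in> rc" "b \<le> c" "pl_on Z \<tau> (\<lambda>x. x - b)" "\<forall>x\<in>Z. x < b"
    obtain h where h: "pl h" "\<forall>x\<in>Z. v (x - b) = h (\<tau> x)" using b(3) by (rule pl_onE)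
    show ?thesis
    proof (cases "c = b")
      case True
      thus ?thesis using b(3) by simp
    next
      case False
      have "v (c - b) \<in> D" using False by (intro v_rc rc_diff b(1) \<open>c \<in> rc\<close>) simp
      show ?thesis
      proof (rule pl_onI)
        show "(- 1::int) \<noteq> 0" by simp
        show "pl (\<lambda>t. min (v (c - b)) (h t))" by (intro pl_min pl_const h(1) \<open>v (c - b) \<in> D\<close>)
        fix x assume x: "x \<in> Z"
        have "x < b" using b(4) x by blast
        thus "sign (x - c) = - 1" using b(2) by (simp add: sign_def)
        have "v ((c - b) + (b - x)) = min (v (c - b)) (v (b - x))"
          using b(2) \<open>x < b\<close> False by (intro v_add_pos) auto
        thus "v (x - c) = min (v (c - b)) (h (\<tau> x))"
          using h(2) x by (simp add: v_diff_commute[of x c] v_diff_commute[of b x])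
      qed
    qed
  qed
qed

section \<open>The shape of the cells on each kind of region\<close>

lemma vo_interval_iff: "vo_interval K v T \<longleftrightarrow> interval_over rc D v T"
  by (simp add: vo_interval_def rc_def D_def)

lemma decomposable_above:
  assumes "cellwise_on {x. a < x} (\<lambda>x. v (x - a)) (\<lambda>x. x \<in> S)" "a \<in> rc"
  shows "decomposable (S \<inter> {x. a < x})"
  using assms(1)
proof (rule decomposable_region[where ?E0.0 = "{}"])
  fix x assume "v (x - a) \<in> D"
  moreover have "{y\<in>{x. a < x}. v (y - a) = v (x - a)} = Ival_plus v a (v (x - a))"
    by (auto simp: Ival_plus_def intro: exI[of _ "_ - a"])
  ultimately show "vo_interval K v {y\<in>{x. a < x}. v (y - a) = v (x - a)}"
    using assms(2) by (simp add: vo_interval_iff interval_over.intros(1))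
next
  fix x \<alpha> \<beta> assume "\<alpha> \<in> Fin ` D \<union> {Minf}" "\<beta> \<in> Fin ` D \<union> {Pinf}" and
    ab: "\<alpha> < Fin (v (x - a))" "Fin (v (x - a)) < \<beta>"
  hence "\<alpha> \<in> Fin ` D \<union> {Minf, Pinf}" "\<beta> \<in> Fin ` D \<union> {Minf, Pinf}" "\<alpha> < \<beta>"
    using less_trans[OF ab] by auto
  moreover have "{y\<in>{x. a < x}. \<alpha> < Fin (v (y - a)) \<and> Fin (v (y - a)) < \<beta>} = Iopen_plus v a \<alpha> \<beta>"
    by (auto simp: Iopen_plus_def intro: exI[of _ "_ - a"])
  ultimately show "vo_interval K v {y\<in>{x. a < x}. \<alpha> < Fin (v (y - a)) \<and> Fin (v (y - a)) < \<beta>}"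
    using assms(2) by (simp only: vo_interval_iff interval_over.intros(3))
qed auto

lemma decomposable_below:
  assumes "cellwise_on {x. x < a} (\<lambda>x. v (a - x)) (\<lambda>x. x \<in> S)" "a \<in> rc"
  shows "decomposable (S \<inter> {x. x < a})"
  using assms(1)
proof (rule decomposable_region[where ?E0.0 = "{}"])
  fix x assume "v (a - x) \<in> D"
  moreover have "{y\<in>{x. x < a}. v (a - y) = v (a - x)} = Ival_minus v a (v (a - x))"
    by (auto simp: Ival_minus_def intro: exI[of _ "a - _"])
  ultimately show "vo_interval K v {y\<in>{x. x < a}. v (a - y) = v (a - x)}"
    using assms(2) by (simp add: vo_interval_iff interval_over.intros(2))
next
  fix x \<alpha> \<beta> assume "\<alpha> \<in> Fin ` D \<union> {Minf}" "\<beta> \<in> Fin ` D \<union> {Pinf}" and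
    ab: "\<alpha> < Fin (v (a - x))" "Fin (v (a - x)) < \<beta>"
  hence "\<alpha> \<in> Fin ` D \<union> {Minf, Pinf}" "\<beta> \<in> Fin ` D \<union> {Minf, Pinf}" "\<alpha> < \<beta>"
    using less_trans[OF ab] by auto
  moreover have "{y\<in>{x. x < a}. \<alpha> < Fin (v (a - y)) \<and> Fin (v (a - y)) < \<beta>} = Iopen_minus v a \<alpha> \<beta>"
    by (auto simp: Iopen_minus_def intro: exI[of _ "a - _"])
  ultimately show "vo_interval K v {y\<in>{x. x < a}. \<alpha> < Fin (v (a - y)) \<and> Fin (v (a - y)) < \<beta>}"
    using assms(2) by (simp only: vo_interval_iff interval_over.intros(4))
qed auto

text \<open>The bound x < b is left implicit: a positive value of t = (x - a)/(b - a) forces t < 1.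
  The regions thus match the intervals \<open>Jval_plus\<close> and \<open>Jopen_plus\<close>, which
  do not bound t by 1 either.\<close>

lemma decomposable_near_left:
  assumes ab: "a \<in> rc" "b \<in> rc" "a < b"
    and S: "cellwise_on {x. a < x \<and> 0 < v ((x - a) / (b - a))} (\<lambda>x. v ((x - a) / (b - a))) (\<lambda>x. x \<in> S)"
      (is "cellwise_on ?Z ?\<tau> _")
  shows "decomposable (S \<inter> ?Z)"
  using S
proof (rule decomposable_region[where ?E0.0 = "{0}"])
  have eq: "x = a + (x - a) / (b - a) * (b - a)" for x using ab by simp
  have div: "a + t * (b - a) - a = t * (b - a)" "t * (b - a) / (b - a) = t" for t using ab by simp_all
  {
    fix x assume x: "x \<in> ?Z" "?\<tau> x \<in> D"
    have "{y\<in>?Z. ?\<tau> y = ?\<tau> x} = Jval_plus v a b (?\<tau> x)"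
    proof (intro equalityI subsetI)
      fix y assume "y \<in> {y\<in>?Z. ?\<tau> y = ?\<tau> x}"
      thus "y \<in> Jval_plus v a b (?\<tau> x)" unfolding Jval_plus_def using eq[of y] ab by fastforce
    next
      fix y assume "y \<in> Jval_plus v a b (?\<tau> x)"
      then obtain t where "y = a + t * (b - a)" "0 < t" "v t = ?\<tau> x" by (auto simp: Jval_plus_def)
      thus "y \<in> {y\<in>?Z. ?\<tau> y = ?\<tau> x}" using x(1) ab by (simp add: div)
    qed
    thus "vo_interval K v {y\<in>?Z. ?\<tau> y = ?\<tau> x}"
      using x ab by (simp add: vo_interval_iff interval_over.intros(5))
  next
    fix x \<alpha> \<beta> assume "\<alpha> \<in> Fin ` D \<union> {Minf}" "\<beta> \<in> Fin ` D \<union> {Pinf}" and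
      less: "\<alpha> < Fin (?\<tau> x)" "Fin (?\<tau> x) < \<beta>" and "\<forall>e\<in>{0}. Fin e \<le> \<alpha>"
    hence \<alpha>\<beta>: "\<alpha> \<in> Fin ` D \<union> {Pinf}" "\<beta> \<in> Fin ` D \<union> {Pinf}" "0 \<le> \<alpha>" "\<alpha> < \<beta>"
      using less_trans[OF less] by (auto simp: zero_extended_def)
    have "{y\<in>?Z. \<alpha> < Fin (?\<tau> y) \<and> Fin (?\<tau> y) < \<beta>} = Jopen_plus v a b \<alpha> \<beta>"
    proof (intro equalityI subsetI)
      fix y assume "y \<in> {y\<in>?Z. \<alpha> < Fin (?\<tau> y) \<and> Fin (?\<tau> y) < \<beta>}"
      thus "y \<in> Jopen_plus v a b \<alpha> \<beta>" unfolding Jopen_plus_def using eq[of y] ab by fastforce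
    next
      fix y assume "y \<in> Jopen_plus v a b \<alpha> \<beta>"
      then obtain t where t: "y = a + t * (b - a)" "0 < t" "\<alpha> < Fin (v t)" "Fin (v t) < \<beta>"
        by (auto simp: Jopen_plus_def)
      \<comment> \<open>The condition 0 <= \<alpha> returns the positivity that defines the
        region.\<close>
      have "0 < v t" using le_less_trans[OF \<alpha>\<beta>(3) t(3)] by (simp add: zero_extended_def)
      thus "y \<in> {y\<in>?Z. \<alpha> < Fin (?\<tau> y) \<and> Fin (?\<tau> y) < \<beta>}" using t ab by (simp add: div)
    qed
    thus "vo_interval K v {y\<in>?Z. \<alpha> < Fin (?\<tau> y) \<and> Fin (?\<tau> y) < \<beta>}"
      using \<alpha>\<beta> ab by (simp only: vo_interval_iff interval_over.intros(7))
  }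
qed (auto simp: D_0)

lemma decomposable_near_right:
  assumes ab: "a \<in> rc" "b \<in> rc" "a < b"
    and S: "cellwise_on {x. x < b \<and> 0 < v ((b - x) / (b - a))} (\<lambda>x. v ((b - x) / (b - a))) (\<lambda>x. x \<in> S)"
      (is "cellwise_on ?Z ?\<tau> _")
  shows "decomposable (S \<inter> ?Z)"
  using S
proof (rule decomposable_region[where ?E0.0 = "{0}"])
  have eq: "x = b - (b - x) / (b - a) * (b - a)" for x using ab by simp
  have div: "b - (b - t * (b - a)) = t * (b - a)" "t * (b - a) / (b - a) = t" for t using ab by simp_all
  {
    fix x assume x: "x \<in> ?Z" "?\<tau> x \<in> D"
    have "{y\<in>?Z. ?\<tau> y = ?\<tau> x} = Jval_minus v a b (?\<tau> x)"
    proof (intro equalityI subsetI)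
      fix y assume "y \<in> {y\<in>?Z. ?\<tau> y = ?\<tau> x}"
      thus "y \<in> Jval_minus v a b (?\<tau> x)" unfolding Jval_minus_def using eq[of y] ab by fastforce
    next
      fix y assume "y \<in> Jval_minus v a b (?\<tau> x)"
      then obtain t where "y = b - t * (b - a)" "0 < t" "v t = ?\<tau> x" by (auto simp: Jval_minus_def)
      thus "y \<in> {y\<in>?Z. ?\<tau> y = ?\<tau> x}" using x(1) ab by (simp add: div)
    qed
    thus "vo_interval K v {y\<in>?Z. ?\<tau> y = ?\<tau> x}"
      using x ab by (simp add: vo_interval_iff interval_over.intros(6))
  next
    fix x \<alpha> \<beta> assume "\<alpha> \<in> Fin ` D \<union> {Minf}" "\<beta> \<in> Fin ` D \<union> {Pinf}" and
      less: "\<alpha> < Fin (?\<tau> x)" "Fin (?\<tau> x) < \<beta>" and "\<forall>e\<in>{0}. Fin e \<le> \<alpha>"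
    hence \<alpha>\<beta>: "\<alpha> \<in> Fin ` D \<union> {Pinf}" "\<beta> \<in> Fin ` D \<union> {Pinf}" "0 \<le> \<alpha>" "\<alpha> < \<beta>"
      using less_trans[OF less] by (auto simp: zero_extended_def)
    have "{y\<in>?Z. \<alpha> < Fin (?\<tau> y) \<and> Fin (?\<tau> y) < \<beta>} = Jopen_minus v a b \<alpha> \<beta>"
    proof (intro equalityI subsetI)
      fix y assume "y \<in> {y\<in>?Z. \<alpha> < Fin (?\<tau> y) \<and> Fin (?\<tau> y) < \<beta>}"
      thus "y \<in> Jopen_minus v a b \<alpha> \<beta>" unfolding Jopen_minus_def using eq[of y] ab by fastforce
    next
      fix y assume "y \<in> Jopen_minus v a b \<alpha> \<beta>"
      then obtain t where t: "y = b - t * (b - a)" "0 < t" "\<alpha> < Fin (v t)" "Fin (v t) < \<beta>"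
        by (auto simp: Jopen_minus_def)
      have "0 < v t" using le_less_trans[OF \<alpha>\<beta>(3) t(3)] by (simp add: zero_extended_def)
      thus "y \<in> {y\<in>?Z. \<alpha> < Fin (?\<tau> y) \<and> Fin (?\<tau> y) < \<beta>}" using t ab by (simp add: div)
    qed
    thus "vo_interval K v {y\<in>?Z. \<alpha> < Fin (?\<tau> y) \<and> Fin (?\<tau> y) < \<beta>}"
      using \<alpha>\<beta> ab by (simp only: vo_interval_iff interval_over.intros(8))
  }
qed (auto simp: D_0)

text \<open>With a constant parameter there is only one cell, so S contains all of this region or
  none of it.\<close>

lemma decomposable_middle:
  assumes ab: "a \<in> rc" "b \<in> rc" "a < b"
    and S: "cellwise_on (Jmid v a b) (\<lambda>_. 0) (\<lambda>x. x \<in> S)"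
  shows "decomposable (S \<inter> Jmid v a b)"
  using S
proof (rule decomposable_region[where ?E0.0 = "{}"])
  have "vo_interval K v (Jmid v a b)"
    using ab by (simp add: vo_interval_iff interval_over.intros(9))
  thus "vo_interval K v {y \<in> Jmid v a b. 0 = 0}" by simp
  thus "vo_interval K v {y \<in> Jmid v a b. \<alpha> < Fin 0 \<and> Fin 0 < \<beta>}"
    if "\<alpha> < Fin 0" "Fin 0 < \<beta>" for \<alpha> \<beta> using that by simp
qed auto

lemma v_between:
  assumes "a < x" "x < b"
  shows "min (v ((x - a) / (b - a))) (v ((b - x) / (b - a))) = 0"
proof -
  have "(x - a) / (b - a) + (b - x) / (b - a) = 1"
    using assms by (simp flip: add_divide_distrib)
  thus ?thesis using assms v_add_pos[of "(x - a) / (b - a)" "(b - x) / (b - a)"] by simp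
qed

lemma Jmid_iff:
  assumes "a < b"
  shows "x \<in> Jmid v a b \<longleftrightarrow>
    a < x \<and> x < b \<and> v ((x - a) / (b - a)) = 0 \<and> v ((b - x) / (b - a)) = 0"
proof
  assume "x \<in> Jmid v a b"
  then obtain t where t: "x = a + t * (b - a)" "0 < t" "t < 1" "v t = 0" "v (1 - t) = 0"
    by (auto simp: Jmid_def)
  have "(x - a) / (b - a) = t" using assms t(1) by simp
  moreover have bx: "b - x = (1 - t) * (b - a)" using t(1) by (simp add: algebra_simps)
  hence "(b - x) / (b - a) = 1 - t" using assms by simp
  moreover have "0 < b - x" unfolding bx using assms t(3) by simp
  moreover have "a < x" using assms t(1,2) by simp
  ultimately show "a < x \<and> x < b \<and> v ((x - a) / (b - a)) = 0 \<and> v ((b - x) / (b - a)) = 0"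
    using t(4,5) by simp
next
  assume x: "a < x \<and> x < b \<and> v ((x - a) / (b - a)) = 0 \<and> v ((b - x) / (b - a)) = 0"
  define t where "t = (x - a) / (b - a)"
  have 1: "1 - t = (b - x) / (b - a)" using assms by (simp add: t_def field_simps)
  have 2: "x = a + t * (b - a)" using assms by (simp add: t_def)
  have 3: "0 < t" "t < 1" using x assms by (simp_all add: t_def)
  have 4: "v t = 0" using x by (simp add: t_def)
  have 5: "v (1 - t) = 0" unfolding 1 using x by simp
  show "x \<in> Jmid v a b"
    unfolding Jmid_def mem_Collect_eq by (intro exI[of _ t] conjI 2 3 4 5)
qed

text \<open>As t and 1 - t are positive with sum 1, the minimum of their values is 0: at most one of
  them is positive. The three regions are therefore disjoint, and on each the two values are the
  parameter or 0.\<close>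

lemma decomposable_gap:
  assumes A: "finite A" "A \<subseteq> rc" "\<And>Z \<tau>. adapted A Z \<tau> \<Longrightarrow> cellwise_on Z \<tau> (\<lambda>x. x \<in> S)"
    and ab: "a \<in> rc" "b \<in> rc" "a < b" "\<And>c. c \<in> A \<Longrightarrow> c \<le> a \<or> b \<le> c"
  shows "decomposable (S \<inter> {x. a < x \<and> x < b})"
proof -
  define L where "L = {x. a < x \<and> 0 < v ((x - a) / (b - a))}"
  define R where "R = {x. x < b \<and> 0 < v ((b - x) / (b - a))}"
  \<comment> \<open>Applied to t and to 1 - t this keeps \<open>L\<close> below b and
    \<open>R\<close> above a.\<close>
  have not_pos: "\<not> 0 < v t" if "1 \<le> t" for t using v_anti_mono[of 1 t] that by simp
  have L: "a < x" "x < b" "v ((b - x) / (b - a)) = 0" "0 < v ((x - a) / (b - a))" if "x \<in> L" for x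
  proof -
    show "a < x" "0 < v ((x - a) / (b - a))" using that by (simp_all add: L_def)
    hence "\<not> b \<le> x" using not_pos[of "(x - a) / (b - a)"] ab(3) by (auto simp: le_divide_eq)
    thus "x < b" by simp
    thus "v ((b - x) / (b - a)) = 0"
      using v_between[OF \<open>a < x\<close> \<open>x < b\<close>] \<open>0 < v ((x - a) / (b - a))\<close>
      by (auto simp: min_def split: if_splits)
  qed
  have R: "a < x" "x < b" "v ((x - a) / (b - a)) = 0" "0 < v ((b - x) / (b - a))" if "x \<in> R" for x
  proof -
    show "x < b" "0 < v ((b - x) / (b - a))" using that by (simp_all add: R_def)
    hence "\<not> x \<le> a" using not_pos[of "(b - x) / (b - a)"] ab(3) by (auto simp: le_divide_eq)
    thus "a < x" by simp
    thus "v ((x - a) / (b - a)) = 0"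
      using v_between[OF \<open>a < x\<close> \<open>x < b\<close>] \<open>0 < v ((b - x) / (b - a))\<close>
      by (auto simp: min_def split: if_splits)
  qed
  have split: "{x. a < x \<and> x < b} = L \<union> Jmid v a b \<union> R"
  proof (intro equalityI subsetI)
    fix x assume "x \<in> {x. a < x \<and> x < b}"
    hence x: "a < x" "x < b" by simp_all
    from v_between[OF this] have "0 \<le> v ((x - a) / (b - a))" "0 \<le> v ((b - x) / (b - a))"
      by (metis min.cobounded1, metis min.cobounded2)
    thus "x \<in> L \<union> Jmid v a b \<union> R"
      using x by (auto simp: L_def R_def Jmid_iff[OF ab(3)])
  next
    fix x assume "x \<in> L \<union> Jmid v a b \<union> R"
    thus "x \<in> {x. a < x \<and> x < b}" using L(1,2) R(1,2) by (auto simp: Jmid_iff[OF ab(3)])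
  qed
  have vab: "v (b - a) \<in> D" using ab by (intro v_rc rc_diff) simp_all
  \<comment> \<open>All three regions are handled at once. f and g give the values of t and 1 - t;
    adding the constant v(b - a) turns them into the values of the distances to a and b, and all of
    \<open>A\<close> lies outside the gap.\<close>
  have cw: "cellwise_on Z \<tau> (\<lambda>x. x \<in> S)"
    if Z: "\<And>x. x \<in> Z \<Longrightarrow> a < x" "\<And>x. x \<in> Z \<Longrightarrow> x < b"
      and f: "pl f" "\<And>x. x \<in> Z \<Longrightarrow> v ((x - a) / (b - a)) = f (\<tau> x)"
      and g: "pl g" "\<And>x. x \<in> Z \<Longrightarrow> v ((b - x) / (b - a)) = g (\<tau> x)" for Z \<tau> f g
  proof (rule A(3), rule adaptedI[OF A(2)])
    fix c assume "c \<in> A"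
    from ab(4)[OF this]
    show "(\<exists>a\<in>rc. c \<le> a \<and> pl_on Z \<tau> (\<lambda>x. x - a) \<and> (\<forall>x\<in>Z. a < x)) \<or>
      (\<exists>b\<in>rc. b \<le> c \<and> pl_on Z \<tau> (\<lambda>x. x - b) \<and> (\<forall>x\<in>Z. x < b))"
    proof
      assume "c \<le> a"
      moreover have "pl_on Z \<tau> (\<lambda>x. x - a)"
      proof (rule pl_onI)
        show "(1::int) \<noteq> 0" by simp
        show "pl (\<lambda>t. f t + v (b - a))" by (intro pl_add pl_const f(1) vab)
        fix x assume x: "x \<in> Z"
        show "sign (x - a) = 1" using Z(1)[OF x] by (intro sign_pos) simp
        show "v (x - a) = f (\<tau> x) + v (b - a)"
          using v_divide[of "x - a" "b - a"] f(2)[OF x] Z(1)[OF x] ab(3) by simp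
      qed
      ultimately show ?thesis using Z(1) ab(1) by blast
    next
      assume "b \<le> c"
      moreover have "pl_on Z \<tau> (\<lambda>x. x - b)"
      proof (rule pl_onI)
        show "(- 1::int) \<noteq> 0" by simp
        show "pl (\<lambda>t. g t + v (b - a))" by (intro pl_add pl_const g(1) vab)
        fix x assume x: "x \<in> Z"
        show "sign (x - b) = - 1" using Z(2)[OF x] by (simp add: sign_def)
        show "v (x - b) = g (\<tau> x) + v (b - a)"
          using v_divide[of "b - x" "b - a"] g(2)[OF x] Z(2)[OF x] ab(3)
          by (simp add: v_diff_commute[of x b])
      qed
      ultimately show ?thesis using Z(2) ab(2) by blast
    qed
  qed
  have "decomposable (S \<inter> L)"
    unfolding L_def
  proof (rule decomposable_near_left[OF ab(1-3)], fold L_def)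
    show "cellwise_on L (\<lambda>x. v ((x - a) / (b - a))) (\<lambda>x. x \<in> S)"
      by (rule cw[of _ "\<lambda>t. t" _ "\<lambda>_. 0"]) (simp_all add: L pl_id pl_const D_0)
  qed
  moreover have "decomposable (S \<inter> R)"
    unfolding R_def
  proof (rule decomposable_near_right[OF ab(1-3)], fold R_def)
    show "cellwise_on R (\<lambda>x. v ((b - x) / (b - a))) (\<lambda>x. x \<in> S)"
      by (rule cw[of _ "\<lambda>_. 0" _ "\<lambda>t. t"]) (simp_all add: R pl_id pl_const D_0)
  qed
  moreover have "decomposable (S \<inter> Jmid v a b)"
  proof (rule decomposable_middle[OF ab(1-3)])
    show "cellwise_on (Jmid v a b) (\<lambda>_. 0) (\<lambda>x. x \<in> S)"
      by (rule cw[of _ "\<lambda>_. 0" _ "\<lambda>_. 0"]) (simp_all add: Jmid_iff[OF ab(3)] pl_const D_0)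
  qed
  moreover have "x \<notin> Jmid v a b" if "x \<in> L" for x using L(4)[OF that] by (auto simp: Jmid_iff[OF ab(3)])
  hence "S \<inter> L \<inter> (S \<inter> Jmid v a b) = {}" by blast
  moreover have "x \<notin> L" "x \<notin> Jmid v a b" if "x \<in> R" for x
    using L(3)[of x] R(4)[OF that] by (auto simp: Jmid_iff[OF ab(3)])
  hence "(S \<inter> L \<union> S \<inter> Jmid v a b) \<inter> (S \<inter> R) = {}" by blast
  ultimately have "decomposable ((S \<inter> L \<union> S \<inter> Jmid v a b) \<union> S \<inter> R)"
    by (intro decomposable_Un)
  also have "(S \<inter> L \<union> S \<inter> Jmid v a b) \<union> S \<inter> R = S \<inter> {x. a < x \<and> x < b}"
    unfolding split by blast
  finally show ?thesis .
qed

theorem constructible_decomposable: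
  assumes "constructible K v S"
  shows "decomposable S"
proof -
  obtain A0 where A0: "finite A0" "A0 \<subseteq> rc" "\<forall>Z \<tau>. adapted A0 Z \<tau> \<longrightarrow> cellwise_on Z \<tau> (\<lambda>x. x \<in> S)"
    using constructible_cellwise[OF assms] unfolding cellwise_def by (elim exE conjE)
  \<comment> \<open>Inserting 0 makes the set nonempty, so that a least element exists even if no
    centers occur.\<close>
  define A where "A = insert 0 A0"
  have "0 \<in> rc" using K_subset_rc is_subfield_0[OF subfield] by blast
  hence A: "finite A" "A \<subseteq> rc" "A \<noteq> {}" using A0(1,2) by (simp_all add: A_def)
  have cw: "cellwise_on Z \<tau> (\<lambda>x. x \<in> S)" if "adapted A Z \<tau>" for Z \<tau>
    using A0(3) adapted_mono[OF that, of A0] by (auto simp: A_def)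
  \<comment> \<open>The open interval from a to the next element of \<open>A\<close>, or the whole
    ray above a if a is the largest.\<close>
  define gap where "gap = (\<lambda>a. {x. a < x \<and> (\<forall>b\<in>A. a < b \<longrightarrow> x < b)})"
  have "decomposable (S \<inter> gap a)" if a: "a \<in> A" for a
  proof (cases "\<exists>b\<in>A. a < b")
    case True
    define b where "b = Min {b\<in>A. a < b}"
    have fin: "finite {b\<in>A. a < b}" using A(1) by simp
    have ne: "{b\<in>A. a < b} \<noteq> {}" using True by auto
    have b: "b \<in> A" "a < b" using Min_in[OF fin ne] by (simp_all add: b_def)
    have b_le: "b \<le> c" if "c \<in> A" "a < c" for c using Min_le[OF fin, of c] that by (simp add: b_def)
    have "gap a = {x. a < x \<and> x < b}"
      unfolding gap_def using b b_le by (auto intro: less_le_trans)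
    moreover have "decomposable (S \<inter> {x. a < x \<and> x < b})"
    proof (rule decomposable_gap[OF A(1,2) cw])
      show "a \<in> rc" "b \<in> rc" using a b A(2) by auto
      show "c \<le> a \<or> b \<le> c" if "c \<in> A" for c using b_le[OF that] by (meson not_less)
    qed (use b in simp_all)
    ultimately show ?thesis by simp
  next
    case False
    hence le: "c \<le> a" if "c \<in> A" for c using that by (auto simp: not_less)
    have gap: "gap a = {x. a < x}" using False by (auto simp: gap_def)
    have "a \<in> rc" using a A(2) by blast
    have "pl_on {x. a < x} (\<lambda>x. v (x - a)) (\<lambda>x. x - a)"
      by (rule pl_onI[of 1 _ _ "\<lambda>t. t"]) (simp_all add: pl_id sign_pos)
    hence "adapted A {x. a < x} (\<lambda>x. v (x - a))"
      using \<open>a \<in> rc\<close> le by (intro adaptedI A(2)) auto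
    thus ?thesis unfolding gap using \<open>a \<in> rc\<close> by (intro decomposable_above cw)
  qed
  moreover have "S \<inter> gap a \<inter> (S \<inter> gap b) = {}" if ab: "a \<in> A" "b \<in> A" "a \<noteq> b" for a b
    using ab by (cases a b rule: linorder_cases) (auto simp: gap_def)
  ultimately have gaps: "decomposable (\<Union>a\<in>A. S \<inter> gap a)"
    using A(1) by (intro decomposable_UN)
  define m where "m = Min A"
  have m: "m \<in> A" using Min_in[OF A(1,3)] by (simp add: m_def)
  have m_le: "m \<le> c" if "c \<in> A" for c using Min_le[OF A(1) that] by (simp add: m_def)
  have "m \<in> rc" using m A(2) by blast
  have "pl_on {x. x < m} (\<lambda>x. v (m - x)) (\<lambda>x. x - m)"
    by (rule pl_onI[of "- 1" _ _ "\<lambda>t. t"]) (simp_all add: pl_id sign_def v_diff_commute)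
  hence "adapted A {x. x < m} (\<lambda>x. v (m - x))"
    using \<open>m \<in> rc\<close> m_le by (intro adaptedI A(2)) auto
  hence below: "decomposable (S \<inter> {x. x < m})"
    using \<open>m \<in> rc\<close> by (intro decomposable_below cw)
  have points: "decomposable (S \<inter> A)" using A by (intro decomposable_finite) auto
  have "S = (S \<inter> A \<union> S \<inter> {x. x < m}) \<union> (\<Union>a\<in>A. S \<inter> gap a)"
  proof (intro equalityI subsetI)
    fix x assume x: "x \<in> S"
    show "x \<in> (S \<inter> A \<union> S \<inter> {x. x < m}) \<union> (\<Union>a\<in>A. S \<inter> gap a)"
    proof (cases "x \<in> A \<or> x < m")
      case False
      define a where "a = Max {a\<in>A. a < x}"
      have fin: "finite {a\<in>A. a < x}" using A(1) by simp
      have "m < x" using False m by (metis linorder_neqE)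
      hence ne: "{a\<in>A. a < x} \<noteq> {}" using m by auto
      have a: "a \<in> A" "a < x" using Max_in[OF fin ne] by (simp_all add: a_def)
      have le_a: "c \<le> a" if "c \<in> A" "c < x" for c using Max_ge[OF fin, of c] that by (simp add: a_def)
      have "x < b" if "b \<in> A" "a < b" for b
        using le_a[of b] that False by (metis linorder_neqE not_less)
      hence "x \<in> gap a" using a by (simp add: gap_def)
      thus ?thesis using x a by blast
    qed (use x in auto)
  qed auto
  moreover have "\<not> c < m" if "c \<in> A" for c using m_le[OF that] by simp
  hence "(S \<inter> A) \<inter> (S \<inter> {x. x < m}) = {}" by blast
  moreover have "x \<notin> A" "\<not> x < m" if "x \<in> gap a" "a \<in> A" for x a
    using that(1) m_le[OF that(2)] by (auto simp: gap_def)
  hence "(S \<inter> A \<union> S \<inter> {x. x < m}) \<inter> (\<Union>a\<in>A. S \<inter> gap a) = {}" by blast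
  ultimately show ?thesis using decomposable_Un[OF decomposable_Un[OF points below] gaps] by simp
qed

end

theorem theorem1p4p4:
  fixes K V V\<^sub>R :: "'r::real_closed_field set"
    and v :: "'r \<Rightarrow> 'g::linordered_ab_group_add"
    and S :: "'r set"
  assumes "ordered_valued_field (UNIV :: 'r set) V\<^sub>R"
    and "ordered_valued_subfield K V UNIV V\<^sub>R"
    and "valuation_of V\<^sub>R v"
    and "constructible K v S"
  shows "\<exists>\<A>. finite \<A> \<and> disjoint \<A> \<and> \<Union>\<A> = S \<and>
           (\<forall>A\<in>\<A>. (\<exists>a\<in>alg_closure_in K. A = {a}) \<or> vo_interval K v A)"
proof -
  interpret valuation V\<^sub>R v K
  proof
    show "is_subring V\<^sub>R"
      using assms(1) by (simp add: ordered_valued_field_def valuation_ring_def)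
    show "x \<in> V\<^sub>R" if "0 \<le> x" "0 \<le> y" "x + y \<in> V\<^sub>R" for x y
      using assms(1) that unfolding ordered_valued_field_def by blast
    show "valuation_of V\<^sub>R v" by fact
    show "is_subfield K"
      using assms(2) by (simp add: ordered_valued_subfield_def ordered_valued_field_def)
  qed
  show ?thesis using constructible_decomposable[OF assms(4)] unfolding decomposable_def .
qed

end
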